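(* Let $K$ be a proper cone of $\mathbb{R}^n$, let $A\in\pi(K)$, and let $F$ be a (not necessarily $A$-invariant) face of $K$. For any $x\in\operatorname{relint}F$ we have $$\operatorname{sp}_A(x)=(\rho_{\widehat F},\nu_{\rho_{\widehat F}}(A|_{\operatorname{span}\widehat F})),$$ where $\widehat F$ is the smallest $A$-invariant face of $K$ including $F$.
   Context: A proper cone of $\mathbb{R}^n$ is a closed convex cone that is pointed ($K\cap(-K)=\{0\}$) and has nonempty interior. $\pi(K)$ is the set of real $n\times n$ matrices $A$ with $AK\subseteq K$. A face of $K$ is a convex subcone $F\subseteq K$ such that $x,y\in K$, $x+y\in F$ imply $x,y\in F$; it is $A$-invariant if $AF\subseteq F$. For an $A$-invariant face $G$, $\rho_G$ denotes the spectral radius of $A|_{\operatorname{span}G}$. For an eigenvalue $\lambda$ of a linear map $B$, $\nu_\lambda(B)$ is the index of $\lambda$ (the size of the largest Jordan block of $B$ for $\lambda$). If $\widehat F=\{0\}$ both entries on the right-hand side are taken to be $0$. Spectral pair of a vector: a generalized eigenvector of $A$ corresponding to $\lambda\in\mathbb{C}$ is a nonzero $x\in\mathbb{C}^n$ with $(\lambda I-A)^kx=0$ for some positive integer $k$; the least such $k$ is its order. A nonzero $x\in\mathbb{C}^n$ is written uniquely as $x=x_1+\dots+x_m$ with $x_i$ generalized eigenvectors of $A$ corresponding to distinct eigenvalues $\lambda_1,\dots,\lambda_m$. Then $\rho_x(A)=\max_i|\lambda_i|$, $\operatorname{ord}_A(x)$ is the maximum of the orders of those $x_i$ with $|\lambda_i|=\rho_x(A)$,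 and $\operatorname{sp}_A(x)=(\rho_x(A),\operatorname{ord}_A(x))$. Also $\operatorname{sp}_A(0)=(0,0)$. *)

theory Defs
  imports
    "HOL-Analysis.Analysis"
    "Jordan_Normal_Form.Jordan_Normal_Form"
    "Jordan_Normal_Form.Spectral_Radius"
begin

no_notation Matrix.vec_index (infixl \<open>$\<close> 100)
no_notation Matrix.scalar_prod (infix \<open>\<bullet>\<close> 70)

definition proper_cone :: "'a::euclidean_space set \<Rightarrow> bool" where
  "proper_cone K \<longleftrightarrow>
     closed K \<and> convex_cone K \<and> K \<inter> uminus ` K = {0} \<and> interior K \<noteq> {}"

definition cone_preserving :: "(real^'n) set \<Rightarrow> (real^'n^'n) set" where
  "cone_preserving K = {A. (*v) A ` K \<subseteq> K}"

definition cone_face :: "'a::real_vector set \<Rightarrow> 'a set \<Rightarrow> bool" where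
  "cone_face K F \<longleftrightarrow> convex_cone F \<and> F \<subseteq> K \<and>
     (\<forall>x\<in>K. \<forall>y\<in>K. x + y \<in> F \<longrightarrow> x \<in> F \<and> y \<in> F)"

definition invariant_face :: "real^'n^'n \<Rightarrow> (real^'n) set \<Rightarrow> (real^'n) set \<Rightarrow> bool" where
  "invariant_face A K G \<longleftrightarrow> cone_face K G \<and> (*v) A ` G \<subseteq> G"

definition least_invariant_face ::
    "real^'n^'n \<Rightarrow> (real^'n) set \<Rightarrow> (real^'n) set \<Rightarrow> (real^'n) set" where
  "least_invariant_face A K F = (LEAST G. invariant_face A K G \<and> F \<subseteq> G)"

text \<open>The least element above exists, and it is the intersection of all candidates.\<close>

lemma least_invariant_face_works:
  assumes K: "convex_cone K" and A: "A \<in> cone_preserving K" and F: "F \<subseteq> K"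
  defines "C \<equiv> {G. invariant_face A K G \<and> F \<subseteq> G}"
  shows "least_invariant_face A K F = \<Inter>C" "least_invariant_face A K F \<in> C"
proof -
  have "K \<in> C"
    using K A F by (auto simp: C_def invariant_face_def cone_face_def cone_preserving_def)
  have face: "convex_cone G" "G \<subseteq> K" "(*v) A ` G \<subseteq> G" "F \<subseteq> G"
    "\<And>x y. x \<in> K \<Longrightarrow> y \<in> K \<Longrightarrow> x + y \<in> G \<Longrightarrow> x \<in> G \<and> y \<in> G" if "G \<in> C" for G
    using that unfolding C_def invariant_face_def cone_face_def by blast+
  have Inter_face: "x \<in> \<Inter>C \<and> y \<in> \<Inter>C" if xy: "x \<in> K" "y \<in> K" "x + y \<in> \<Inter>C" for x y
  proof -
    have "x \<in> G \<and> y \<in> G" if "G \<in> C" for G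
      using face(5)[OF that xy(1,2)] xy(3) that by simp
    thus ?thesis by simp
  qed
  have cc: "convex_cone (\<Inter>C)"
    using face(1) by (intro convex_cone_Inter) blast
  have sub: "\<Inter>C \<subseteq> K"
    using \<open>K \<in> C\<close> by (rule Inter_lower)
  have cf: "cone_face K (\<Inter>C)"
    unfolding cone_face_def
  proof (intro conjI[OF cc] conjI[OF sub] ballI impI)
    fix x y assume "x \<in> K" "y \<in> K" "x + y \<in> \<Inter>C"
    thus "x \<in> \<Inter>C \<and> y \<in> \<Inter>C" by (rule Inter_face)
  qed
  have inv: "(*v) A ` \<Inter>C \<subseteq> \<Inter>C" and F: "F \<subseteq> \<Inter>C"
    using face(3,4) by blast+
  have "invariant_face A K (\<Inter>C) \<and> F \<subseteq> \<Inter>C"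
    unfolding invariant_face_def by (intro conjI cf inv F)
  moreover from this show "least_invariant_face A K F = \<Inter>C"
    unfolding least_invariant_face_def by (intro Least_equality) (auto simp: C_def)
  ultimately show "least_invariant_face A K F \<in> C"
    by (simp add: C_def)
qed

definition is_basis_of :: "'a::real_vector list \<Rightarrow> 'a set \<Rightarrow> bool" where
  "is_basis_of bs W \<longleftrightarrow> distinct bs \<and> \<not> Real_Vector_Spaces.dependent (set bs)
     \<and> Real_Vector_Spaces.span (set bs) = W"

text \<open>Column \<open>j\<close> holds the coordinates of the image of the \<open>j\<close>-th basis vector.  The matrix is
  taken over the complex numbers because the eigenvalues of a restriction are understood there.\<close>

definition coord_matrix :: "real^'n^'n \<Rightarrow> (real^'n) list \<Rightarrow> complex Matrix.mat" where
  "coord_matrix A bs = Matrix.mat (length bs) (length bs)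
     (\<lambda>(i, j). complex_of_real (Real_Vector_Spaces.representation (set bs) (A *v (bs ! j)) (bs ! i)))"

text \<open>Meaningful when \<open>W\<close> is an \<open>A\<close>-invariant subspace.  The spectral radius and the Jordan
  structure do not depend on the chosen basis, see \<open>similar_coord_matrix\<close>.\<close>

definition restriction_matrix :: "real^'n^'n \<Rightarrow> (real^'n) set \<Rightarrow> complex Matrix.mat" where
  "restriction_matrix A W = coord_matrix A (SOME bs. is_basis_of bs W)"

definition eigenvalue_index :: "complex Matrix.mat \<Rightarrow> complex \<Rightarrow> nat" where
  "eigenvalue_index B l = Max {k. \<exists>n_as. jordan_nf B n_as \<and> (k, l) \<in> set n_as}"

lemma ex_is_basis_of:
  fixes W :: "'a::euclidean_space set"
  assumes "Real_Vector_Spaces.subspace W"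
  shows "\<exists>bs. is_basis_of bs W"
proof -
  obtain B where B: "B \<subseteq> W" "\<not> Real_Vector_Spaces.dependent B" "W \<subseteq> Real_Vector_Spaces.span B"
    using real_vector.basis_exists by metis
  have "finite B"
    using B(2) by (rule independent_imp_finite)
  then obtain bs where "set bs = B" "distinct bs"
    using finite_distinct_list by blast
  moreover have "Real_Vector_Spaces.span B = W"
    using B assms real_vector.span_minimal by blast
  ultimately show ?thesis
    using B unfolding is_basis_of_def by blast
qed

lemma sum_representation_basis:
  assumes "is_basis_of bs W" "v \<in> W"
  shows "(\<Sum>i<length bs. Real_Vector_Spaces.representation (set bs) v (bs ! i) *\<^sub>R bs ! i) = v"
proof -
  have "(\<Sum>i<length bs. Real_Vector_Spaces.representation (set bs) v (bs ! i) *\<^sub>R bs ! i)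
      = (\<Sum>b\<in>set bs. Real_Vector_Spaces.representation (set bs) v b *\<^sub>R b)"
    using assms(1) unfolding is_basis_of_def
    by (intro sum.reindex_bij_betw[OF bij_betw_nth]) auto
  also have "\<dots> = v"
    using assms unfolding is_basis_of_def
    by (intro real_vector.sum_representation_eq) auto
  finally show ?thesis .
qed

lemma representation_trans:
  assumes bs: "is_basis_of bs W" and cs: "is_basis_of cs W" and v: "v \<in> W"
  shows "Real_Vector_Spaces.representation (set cs) v c
    = (\<Sum>i<length bs. Real_Vector_Spaces.representation (set bs) v (bs ! i)
         * Real_Vector_Spaces.representation (set cs) (bs ! i) c)"
proof -
  have ind: "\<not> Real_Vector_Spaces.dependent (set cs)" and span: "Real_Vector_Spaces.span (set cs) = W"
    using cs by (auto simp: is_basis_of_def)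
  have inW: "bs ! i \<in> W" if "i < length bs" for i
    using that bs by (auto simp: is_basis_of_def real_vector.span_base)
  have "Real_Vector_Spaces.representation (set cs) v c = Real_Vector_Spaces.representation (set cs)
      (\<Sum>i<length bs. Real_Vector_Spaces.representation (set bs) v (bs ! i) *\<^sub>R bs ! i) c"
    using sum_representation_basis[OF bs v] by simp
  also have "\<dots> = (\<Sum>i<length bs. Real_Vector_Spaces.representation (set cs)
      (Real_Vector_Spaces.representation (set bs) v (bs ! i) *\<^sub>R bs ! i) c)"
    using inW span
    by (subst real_vector.representation_sum[OF ind]) (auto intro: real_vector.span_scale)
  also have "\<dots> = (\<Sum>i<length bs. Real_Vector_Spaces.representation (set bs) v (bs ! i)
         * Real_Vector_Spaces.representation (set cs) (bs ! i) c)"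
    using inW span by (intro sum.cong) (auto simp: real_vector.representation_scale[OF ind])
  finally show ?thesis .
qed

lemma similar_coord_matrix:
  fixes A :: "real^'n^'n"
  assumes bs: "is_basis_of bs W" and cs: "is_basis_of cs W" and A: "(*v) A ` W \<subseteq> W"
  shows "similar_mat (coord_matrix A bs) (coord_matrix A cs)"
proof -
  define n where "n = length bs"
  let ?r = "\<lambda>bs. Real_Vector_Spaces.representation (set bs)"
  have "card (set bs) = card (set cs)"
    using bs cs unfolding is_basis_of_def by (metis real_vector.dim_eq_card)
  hence len: "length bs = n" "length cs = n"
    using bs cs by (auto simp: is_basis_of_def distinct_card n_def)
  have inW: "as ! i \<in> W" if "is_basis_of as W" "i < length as" for as i
    using that by (auto simp: is_basis_of_def real_vector.span_base)
  define T :: "(real^'n) list \<Rightarrow> (real^'n) list \<Rightarrow> complex Matrix.mat"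
    where "T = (\<lambda>as as'. Matrix.mat n n (\<lambda>(i, j). complex_of_real (?r as' (as ! j) (as' ! i))))"
  have T: "T as as' \<in> carrier_mat n n" for as as'
    by (simp add: T_def)
  have C: "coord_matrix A as \<in> carrier_mat n n" if "length as = n" for as
    using that by (simp add: coord_matrix_def)
  have TT: "T bs cs * T cs bs = 1\<^sub>m n" if bs: "is_basis_of bs W" "length bs = n"
    and cs: "is_basis_of cs W" "length cs = n" for bs cs
  proof (rule eq_matI)
    fix i j assume "i < dim_row (1\<^sub>m n)" "j < dim_col (1\<^sub>m n)"
    hence ij: "i < n" "j < n" by auto
    have "(T bs cs * T cs bs) $$ (i, j)
        = (\<Sum>k<n. complex_of_real (?r bs (cs ! j) (bs ! k) * ?r cs (bs ! k) (cs ! i)))"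
      using ij by (simp add: T_def scalar_prod_def atLeast0LessThan mult.commute)
    also have "\<dots> = complex_of_real (?r cs (cs ! j) (cs ! i))"
      using representation_trans[OF bs(1) cs(1) inW[OF cs(1)], of j "cs ! i"] ij bs cs by simp
    also have "\<dots> = 1\<^sub>m n $$ (i, j)"
    proof -
      have "?r cs (cs ! j) = (\<lambda>b. if b = cs ! j then 1 else 0)"
        using cs ij by (intro real_vector.representation_basis) (auto simp: is_basis_of_def)
      thus ?thesis
        using ij cs by (auto simp: is_basis_of_def nth_eq_iff_index_eq)
    qed
    finally show "(T bs cs * T cs bs) $$ (i, j) = 1\<^sub>m n $$ (i, j)" .
  qed (auto simp: T_def)
  have comm: "T bs cs * coord_matrix A bs = coord_matrix A cs * T bs cs"
  proof (rule eq_matI)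
    fix i j assume "i < dim_row (coord_matrix A cs * T bs cs)"
      "j < dim_col (coord_matrix A cs * T bs cs)"
    hence ij: "i < n" "j < n" using len by (auto simp: T_def coord_matrix_def)
    have bj: "bs ! j \<in> W" using inW[OF bs] ij len by auto
    have AbW: "A *v (bs ! j) \<in> W" using A bj by (simp add: image_subset_iff)
    have ind: "\<not> Real_Vector_Spaces.dependent (set cs)" and span: "Real_Vector_Spaces.span (set cs) = W"
      using cs by (auto simp: is_basis_of_def)
    have AcW: "A *v (cs ! k) \<in> W" if "k < n" for k
      using A inW[OF cs, of k] len that by (simp add: image_subset_iff)
    have "(T bs cs * coord_matrix A bs) $$ (i, j)
        = complex_of_real (?r cs (A *v (bs ! j)) (cs ! i))"
      using ij len representation_trans[OF bs cs AbW, of "cs ! i"]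
      by (simp add: T_def coord_matrix_def scalar_prod_def atLeast0LessThan mult.commute)
    also have "A *v (bs ! j) = A *v (\<Sum>k<n. ?r cs (bs ! j) (cs ! k) *\<^sub>R cs ! k)"
      using sum_representation_basis[OF cs bj] len by simp
    also have "\<dots> = (\<Sum>k<n. ?r cs (bs ! j) (cs ! k) *\<^sub>R (A *v (cs ! k)))"
      by (simp only: linear_sum[OF matrix_vector_mul_linear[of A]]
          linear_scale[OF matrix_vector_mul_linear[of A]])
    also have "?r cs \<dots> (cs ! i) = (\<Sum>k<n. ?r cs (bs ! j) (cs ! k) * ?r cs (A *v (cs ! k)) (cs ! i))"
    proof -
      have "?r cs (\<Sum>k<n. ?r cs (bs ! j) (cs ! k) *\<^sub>R (A *v (cs ! k))) (cs ! i)
          = (\<Sum>k<n. ?r cs (?r cs (bs ! j) (cs ! k) *\<^sub>R (A *v (cs ! k))) (cs ! i))"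
        using AcW span
        by (subst real_vector.representation_sum[OF ind]) (auto intro: real_vector.span_scale)
      also have "\<dots> = (\<Sum>k<n. ?r cs (bs ! j) (cs ! k) * ?r cs (A *v (cs ! k)) (cs ! i))"
        using AcW span by (intro sum.cong) (auto simp: real_vector.representation_scale[OF ind])
      finally show ?thesis .
    qed
    also have "complex_of_real \<dots> = (coord_matrix A cs * T bs cs) $$ (i, j)"
      using ij len
      by (simp add: T_def coord_matrix_def scalar_prod_def atLeast0LessThan mult.commute)
    finally show "(T bs cs * coord_matrix A bs) $$ (i, j)
      = (coord_matrix A cs * T bs cs) $$ (i, j)" .
  qed (use len in \<open>auto simp: T_def coord_matrix_def\<close>)
  have "similar_mat_wit (coord_matrix A bs) (coord_matrix A cs) (T cs bs) (T bs cs)"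
  proof (rule similar_mat_witI)
    show "T cs bs * T bs cs = 1\<^sub>m n" "T bs cs * T cs bs = 1\<^sub>m n"
      using TT bs cs len by auto
    have "T cs bs * coord_matrix A cs * T bs cs = T cs bs * (T bs cs * coord_matrix A bs)"
      using comm T C len by (simp add: assoc_mult_mat[of _ n n _ n _ n])
    also have "\<dots> = (T cs bs * T bs cs) * coord_matrix A bs"
      using T C len by (simp add: assoc_mult_mat[of _ n n _ n _ n])
    also have "\<dots> = coord_matrix A bs"
      using TT[OF cs _ bs] left_mult_one_mat[OF C[of bs]] len by simp
    finally show "coord_matrix A bs = T cs bs * coord_matrix A cs * T bs cs" by simp
  qed (use T C len in auto)
  thus ?thesis
    unfolding similar_mat_def by blast
qed

definition eigen_shift :: "complex^'n^'n \<Rightarrow> complex \<Rightarrow> complex^'n \<Rightarrow> complex^'n" where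
  "eigen_shift A l = (\<lambda>x. (Finite_Cartesian_Product.mat l - A) *v x)"

definition gen_eigenvector :: "complex^'n^'n \<Rightarrow> complex \<Rightarrow> complex^'n \<Rightarrow> bool" where
  "gen_eigenvector A l x \<longleftrightarrow> x \<noteq> 0 \<and> (\<exists>k>0. (eigen_shift A l ^^ k) x = 0)"

definition gen_eigenvector_order :: "complex^'n^'n \<Rightarrow> complex \<Rightarrow> complex^'n \<Rightarrow> nat" where
  "gen_eigenvector_order A l x = (LEAST k. k > 0 \<and> (eigen_shift A l ^^ k) x = 0)"

text \<open>The decomposition of \<open>x\<close> into generalized eigenvectors for distinct eigenvalues is encoded
  as a function \<open>c\<close> that sends each eigenvalue occurring in it to the corresponding summand, and
  all other numbers to \<open>0\<close>.\<close>

definition gen_eigen_decomposition ::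
    "complex^'n^'n \<Rightarrow> complex^'n \<Rightarrow> (complex \<Rightarrow> complex^'n) \<Rightarrow> bool" where
  "gen_eigen_decomposition A x c \<longleftrightarrow> finite {l. c l \<noteq> 0} \<and>
     (\<forall>l. c l \<noteq> 0 \<longrightarrow> gen_eigenvector A l (c l)) \<and> x = (\<Sum>l | c l \<noteq> 0. c l)"

definition gen_eigen_component :: "complex^'n^'n \<Rightarrow> complex^'n \<Rightarrow> complex \<Rightarrow> complex^'n" where
  "gen_eigen_component A x = (THE c. gen_eigen_decomposition A x c)"

definition occurring_eigenvalues :: "complex^'n^'n \<Rightarrow> complex^'n \<Rightarrow> complex set" where
  "occurring_eigenvalues A x = {l. gen_eigen_component A x l \<noteq> 0}"

definition local_spectral_radius :: "complex^'n^'n \<Rightarrow> complex^'n \<Rightarrow> real" where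
  "local_spectral_radius A x = Max (norm ` occurring_eigenvalues A x)"

definition vector_order :: "complex^'n^'n \<Rightarrow> complex^'n \<Rightarrow> nat" where
  "vector_order A x = Max ((\<lambda>l. gen_eigenvector_order A l (gen_eigen_component A x l)) `
     {l \<in> occurring_eigenvalues A x. norm l = local_spectral_radius A x})"

definition spectral_pair :: "complex^'n^'n \<Rightarrow> complex^'n \<Rightarrow> real \<times> nat" where
  "spectral_pair A x =
     (if x = 0 then (0, 0) else (local_spectral_radius A x, vector_order A x))"

definition complex_vec :: "real^'n \<Rightarrow> complex^'n" where
  "complex_vec x = (\<chi> i. complex_of_real (x $ i))"

end

theory Submission
  imports Defs "Jordan_Normal_Form.Jordan_Normal_Form_Uniqueness"
begin

no_notation Matrix.vec_index (infixl \<open>$\<close> 100)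
no_notation Matrix.scalar_prod (infix \<open>\<bullet>\<close> 70)

text \<open>Every vector \<open>g\<close> of the least invariant face is dominated, in the order of \<open>K\<close>, by a nonnegative
  combination \<open>w\<close> of the orbit \<open>x, A x, A\<^sup>2 x, \<dots>\<close>.  For a functional \<open>\<phi>\<close> in the dual cone this gives
  \<open>0 \<le> \<phi> (A\<^sup>k g) \<le> \<phi> (A\<^sup>k w)\<close>, so the generating function \<open>\<Sum>k. z\<^sup>k \<phi> (A\<^sup>k g)\<close> is bounded by the one
  of \<open>w\<close> at \<open>\<bar>z\<bar>\<close>.  Both are rational, with a pole at \<open>1 / \<lambda>\<close> whose order is the order of the
  \<open>\<lambda>\<close>-component.  Letting \<open>z\<close> tend radially to \<open>1 / \<lambda>\<close> shows that the components of \<open>g\<close> have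
  \<open>\<bar>\<lambda>\<bar> \<le> \<rho>\<close>, the local spectral radius of \<open>x\<close>, and that on the circle \<open>\<bar>\<lambda>\<bar> = \<rho>\<close> their order is at
  most that of the \<open>\<rho>\<close>-component of \<open>x\<close>; the case \<open>\<rho> = 0\<close> is a direct nilpotency argument.  Since
  the face spans its linear hull and contains \<open>x\<close>, these are the spectral radius and index there.\<close>

section \<open>Jordan block sizes from kernels\<close>

text \<open>Nested subspaces of equal finite dimension coincide. This passes from dimensions, in
  which Jordan block sizes are expressed, to the kernels as sets.\<close>

lemma kernel_dim_eq_imp_kernel_eq:
  fixes C D :: "'a::field Matrix.mat"
  assumes C: "C \<in> carrier_mat n n" and D: "D \<in> carrier_mat n n"
    and sub: "mat_kernel C \<subseteq> mat_kernel D" and eq: "kernel_dim C = kernel_dim D"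
  shows "mat_kernel C = mat_kernel D"
proof -
  interpret KC: kernel n n C by unfold_locales (rule C)
  interpret KD: kernel n n D by unfold_locales (rule D)
  obtain b where b: "finite b" "KC.basis b"
    using kernel_basis_exists[OF C] by blast
  have bC: "KC.lin_indpt b" "KC.span b = mat_kernel C" "b \<subseteq> mat_kernel C"
    using b(2) unfolding KC.Ker.basis_def by auto
  have bD: "b \<subseteq> mat_kernel D"
    using bC(3) sub by blast
  \<comment> \<open>The two kernels carry module structures of their own; independence and span are
    compared through the ambient space \<open>KC.NC.V\<close>, of which both are submodules.\<close>
  have subC: "LinearCombinations.submodule class_ring (mat_kernel C) KC.NC.V"
    and subD: "LinearCombinations.submodule class_ring (mat_kernel D) KC.NC.V"
    using KC.Ker.module_axioms KD.Ker.module_axioms C D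
    by (auto simp: LinearCombinations.submodule_def mat_kernel KC.NC.module_axioms
        mult_add_distrib_mat_vec[of _ n n] mult_mat_vec[of _ n n] class_ring_simps)
  have li: "KD.lin_indpt b"
    using KC.NC.span_li_not_depend(2)[OF bC(3) subC] KC.NC.span_li_not_depend(2)[OF bD subD] bC(1)
    by simp
  have sp: "KD.span b = KC.span b"
    using KC.NC.span_li_not_depend(1)[OF bC(3) subC] KC.NC.span_li_not_depend(1)[OF bD subD]
    by simp
  obtain b' where b': "finite b'" "KD.basis b'"
    using kernel_basis_exists[OF D] by blast
  have "KD.Ker.fin_dim"
    using b' unfolding KD.Ker.fin_dim_def KD.Ker.basis_def by blast
  moreover have "KD.dim \<le> card b"
    using eq KC.Ker.dim_basis[OF b] by simp
  ultimately have "KD.basis b"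
    using KD.Ker.dim_li_is_basis b(1) bD li by blast
  thus ?thesis
    using sp bC(2) unfolding KD.Ker.basis_def by simp
qed

lemma kernel_dim_cong:
  assumes "mat_kernel C = mat_kernel D" "dim_col C = dim_col D"
  shows "kernel_dim C = kernel_dim D"
  using assms unfolding kernel_dim_def by simp

lemma mat_kernel_pow_mono:
  fixes C :: "'a::field Matrix.mat"
  assumes C: "C \<in> carrier_mat n n"
  shows "mat_kernel (C ^\<^sub>m k) \<subseteq> mat_kernel (C ^\<^sub>m Suc k)"
proof -
  have "C ^\<^sub>m Suc k = C * C ^\<^sub>m k"
  proof (induction k)
    case (Suc k)
    have "C ^\<^sub>m Suc (Suc k) = (C * C ^\<^sub>m k) * C"
      using Suc.IH by simp
    also have "\<dots> = C * C ^\<^sub>m Suc k"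
      using assoc_mult_mat[OF C pow_carrier_mat[OF C] C] by simp
    finally show ?case .
  qed (use C in simp)
  thus ?thesis
    using mat_kernel_mult_subset[OF pow_carrier_mat[OF C, of k] C] by simp
qed

text \<open>When \<open>xs\<close> lists the block sizes of an eigenvalue, the sum of
  \<open>min k n\<close> is the dimension of the kernel of the \<open>k\<close>-th power. Passing to
  \<open>Suc k\<close> adds one for each block longer than \<open>k\<close>.\<close>

lemma sum_list_min_eq_iff:
  fixes xs :: "nat list"
  shows "(\<Sum>n\<leftarrow>xs. min (Suc k) n) = (\<Sum>n\<leftarrow>xs. min k n) \<longleftrightarrow> (\<forall>n\<in>set xs. n \<le> k)"
proof (induction xs)
  case (Cons a xs)
  have "(\<Sum>n\<leftarrow>xs. min k n) \<le> (\<Sum>n\<leftarrow>xs. min (Suc k) n)"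
    by (intro sum_list_mono) auto
  thus ?case
    using Cons by (auto simp: min_def split: if_splits)
qed simp

text \<open>The index is the place where the kernels of the powers stop growing: growth after
  \<open>k\<close> gives a block longer than \<open>k\<close>, and no growth after
  \<open>Suc k\<close> excludes blocks longer than \<open>Suc k\<close>.\<close>

lemma eigenvalue_index_eqI:
  assumes B: "B \<in> carrier_mat d d"
    and grow: "mat_kernel (char_matrix B l ^\<^sub>m k) \<noteq> mat_kernel (char_matrix B l ^\<^sub>m Suc k)"
    and stable: "mat_kernel (char_matrix B l ^\<^sub>m Suc (Suc k)) = mat_kernel (char_matrix B l ^\<^sub>m Suc k)"
  shows "eigenvalue_index B l = Suc k"
proof -
  let ?C = "char_matrix B l"
  have C: "?C \<in> carrier_mat d d" using B by simp
  note Cp = pow_carrier_mat[OF C]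
  have ne: "dim_gen_eigenspace B l (Suc k) \<noteq> dim_gen_eigenspace B l k"
    using kernel_dim_eq_imp_kernel_eq[OF Cp Cp mat_kernel_pow_mono[OF C]] grow
    unfolding dim_gen_eigenspace_def by metis
  have st: "dim_gen_eigenspace B l (Suc (Suc k)) = dim_gen_eigenspace B l (Suc k)"
    unfolding dim_gen_eigenspace_def
    using Cp stable by (intro kernel_dim_cong) (auto simp del: pow_mat.simps)
  \<comment> \<open>Both facts are proved for every Jordan normal form, because the set in
    \<open>eigenvalue_index_def\<close> ranges over all of them.\<close>
  have sizes: "(Suc k, l) \<in> set n_as" "\<And>n. (n, l) \<in> set n_as \<Longrightarrow> n \<le> Suc k"
    if jnf: "jordan_nf B n_as" for n_as
  proof -
    let ?xs = "map fst [(n, e)\<leftarrow>n_as. e = l]"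
    have xs: "n \<in> set ?xs \<longleftrightarrow> (n, l) \<in> set n_as" for n
      by force
    have le: "\<forall>n\<in>set ?xs. n \<le> Suc k"
      using st unfolding dim_gen_eigenspace[OF jnf] sum_list_min_eq_iff .
    thus "n \<le> Suc k" if "(n, l) \<in> set n_as" for n
      using that xs by blast
    have "\<not> (\<forall>n\<in>set ?xs. n \<le> k)"
      using ne unfolding dim_gen_eigenspace[OF jnf] sum_list_min_eq_iff .
    then obtain n where "n \<in> set ?xs" "\<not> n \<le> k" by blast
    moreover have "n \<le> Suc k" using le \<open>n \<in> set ?xs\<close> by blast
    ultimately show "(Suc k, l) \<in> set n_as"
      using xs by (metis le_SucE)
  qed
  obtain n_as where "jordan_nf B n_as"
    using char_poly_factorized[OF B] jordan_nf_exists[OF B] by blast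
  thus ?thesis
    unfolding eigenvalue_index_def
    by (intro Max_eqI) (use sizes in \<open>auto intro: finite_subset[of _ "{..Suc k}"]\<close>)
qed

section \<open>Generalized eigenspaces\<close>

context
  fixes M :: "complex^'n^'n"
begin

lemma eigen_shift_eq: "eigen_shift M l v = l *s v - M *v v"
proof -
  have "Finite_Cartesian_Product.mat l *v v = l *s v"
    by (simp add: Finite_Cartesian_Product.vec_eq_iff matrix_vector_mult_def Finite_Cartesian_Product.mat_def
        if_distrib[of "\<lambda>x. x * _"] vector_scalar_mult_def cong: if_cong)
  thus ?thesis
    unfolding eigen_shift_def by (simp add: matrix_vector_mult_diff_rdistrib)
qed

lemma eigen_shift_add: "eigen_shift M l (u + v) = eigen_shift M l u + eigen_shift M l v"
  unfolding eigen_shift_def by (simp add: matrix_vector_right_distrib)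

lemma eigen_shift_scale: "eigen_shift M l (c *s v) = c *s eigen_shift M l v"
  unfolding eigen_shift_def by (simp add: vector_scalar_commute)

lemma eigen_shift_zero [simp]: "eigen_shift M l 0 = 0"
  unfolding eigen_shift_def by simp

lemma eigen_shift_pow_zero [simp]: "(eigen_shift M l ^^ k) 0 = 0"
  by (induction k) auto

lemma eigen_shift_pow_add: "(eigen_shift M l ^^ k) (u + v) = (eigen_shift M l ^^ k) u + (eigen_shift M l ^^ k) v"
  by (induction k) (auto simp: eigen_shift_add)

lemma eigen_shift_pow_scale: "(eigen_shift M l ^^ k) (c *s v) = c *s (eigen_shift M l ^^ k) v"
  by (induction k) (auto simp: eigen_shift_scale)

lemma eigen_shift_pow_sum: "(eigen_shift M l ^^ k) (sum f S) = (\<Sum>i\<in>S. (eigen_shift M l ^^ k) (f i))"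
  by (induction S rule: infinite_finite_induct) (auto simp: eigen_shift_pow_add)

lemma eigen_shift_commute: "eigen_shift M l (eigen_shift M m v) = eigen_shift M m (eigen_shift M l v)"
  by (simp add: eigen_shift_eq algebra_simps matrix_vector_mult_diff_distrib vector_scalar_commute
      vector_ssub_ldistrib vector_smult_assoc)

lemma eigen_shift_matrix_commute: "eigen_shift M l (M *v v) = M *v eigen_shift M l v"
  by (simp add: eigen_shift_eq matrix_vector_mult_diff_distrib vector_scalar_commute)

lemma eigen_shift_pow_commute: "(eigen_shift M l ^^ k) (eigen_shift M m v) = eigen_shift M m ((eigen_shift M l ^^ k) v)"
  by (induction k) (auto simp: eigen_shift_commute)

lemma eigen_shift_pow_matrix_commute: "(eigen_shift M l ^^ k) (M *v v) = M *v (eigen_shift M l ^^ k) v"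
  by (induction k) (auto simp: eigen_shift_matrix_commute)

lemma eigen_shift_pow_mono:
  assumes "(eigen_shift M l ^^ k) v = 0" "k \<le> j"
  shows "(eigen_shift M l ^^ j) v = 0"
proof -
  have "(eigen_shift M l ^^ j) v = (eigen_shift M l ^^ (j - k)) ((eigen_shift M l ^^ k) v)"
    using assms(2) by (metis comp_apply funpow_add le_add_diff_inverse2)
  thus ?thesis using assms(1) by simp
qed

text \<open>Unlike \<open>gen_eigenvector\<close>, this admits the zero vector and the exponent
  \<open>0\<close>, which makes it a subspace.\<close>

definition gen_eigenspace :: "complex \<Rightarrow> (complex^'n) set" where
  "gen_eigenspace l = {v. \<exists>k. (eigen_shift M l ^^ k) v = 0}"

lemma subspace_gen_eigenspace: "vec.subspace (gen_eigenspace l)"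
proof (rule vec.subspaceI)
  fix u v assume "u \<in> gen_eigenspace l" "v \<in> gen_eigenspace l"
  then obtain j k where "(eigen_shift M l ^^ j) u = 0" "(eigen_shift M l ^^ k) v = 0"
    by (auto simp: gen_eigenspace_def)
  hence "(eigen_shift M l ^^ max j k) (u + v) = 0"
    using eigen_shift_pow_mono[where l = l and j = "max j k"] by (simp add: eigen_shift_pow_add)
  thus "u + v \<in> gen_eigenspace l" by (auto simp: gen_eigenspace_def)
qed (auto simp: gen_eigenspace_def eigen_shift_pow_scale)

lemma eigen_shift_in_gen_eigenspace:
  "v \<in> gen_eigenspace l \<Longrightarrow> eigen_shift M m v \<in> gen_eigenspace l"
  unfolding gen_eigenspace_def by (auto simp: eigen_shift_pow_commute) (metis eigen_shift_zero)

lemma eigen_shift_pow_in_gen_eigenspace: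
  "v \<in> gen_eigenspace l \<Longrightarrow> (eigen_shift M m ^^ k) v \<in> gen_eigenspace l"
  by (induction k) (auto simp: eigen_shift_in_gen_eigenspace)

text \<open>A vector killed by the shift at \<open>m\<close> is an eigenvector for \<open>m\<close>,
  on which the shift at \<open>l\<close> acts as the nonzero scalar \<open>l - m\<close>. No power
  of that scalar can kill a nonzero vector.\<close>

lemma eigen_shift_inj_on_gen_eigenspace:
  assumes v: "v \<in> gen_eigenspace l" and "eigen_shift M m v = 0" and "m \<noteq> l"
  shows "v = 0"
proof -
  obtain k where k: "(eigen_shift M l ^^ k) v = 0"
    using v by (auto simp: gen_eigenspace_def)
  have "eigen_shift M l v = (l - m) *s v + eigen_shift M m v"
    by (simp add: eigen_shift_eq vector_sub_rdistrib)
  hence "eigen_shift M l v = (l - m) *s v" using assms by simp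
  hence "(eigen_shift M l ^^ j) v = (l - m) ^ j *s v" for j
    by (induction j)
      (auto simp: eigen_shift_scale vector_smult_assoc mult.commute simp del: vector_sub_rdistrib)
  thus ?thesis using k \<open>m \<noteq> l\<close> by (simp add: vec.scale_eq_0_iff)
qed

lemma eigen_shift_pow_inj_on_gen_eigenspace:
  assumes v: "v \<in> gen_eigenspace l" and "(eigen_shift M m ^^ k) v = 0" and "m \<noteq> l"
  shows "v = 0"
  using assms(2)
proof (induction k)
  case (Suc k)
  thus ?case
    using eigen_shift_inj_on_gen_eigenspace[OF eigen_shift_pow_in_gen_eigenspace[OF v]] assms(3)
    by auto
qed simp

text \<open>A nilpotent perturbation of a nonzero multiple of the identity is onto.\<close>

lemma eigen_shift_surj_on_gen_eigenspace:
  assumes U: "vec.subspace U" "\<And>v. v \<in> U \<Longrightarrow> M *v v \<in> U"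
    and v: "v \<in> U" "v \<in> gen_eigenspace l" and "m \<noteq> l"
  shows "\<exists>u\<in>U \<inter> gen_eigenspace l. eigen_shift M m u = v"
proof -
  have EU: "eigen_shift M l u \<in> U" if "u \<in> U" for u
    unfolding eigen_shift_eq using that U by (intro vec.subspace_diff vec.subspace_scale)
  obtain k where "(eigen_shift M l ^^ k) v = 0"
    using v by (auto simp: gen_eigenspace_def)
  thus ?thesis using v(1)
  proof (induction k arbitrary: v)
    case 0
    thus ?case
      using vec.subspace_0[OF U(1)] vec.subspace_0[OF subspace_gen_eigenspace]
      by (intro bexI[of _ 0]) auto
  next
    case (Suc k)
    have "(eigen_shift M l ^^ k) (eigen_shift M l v) = 0" using Suc.prems(1) by (simp add: funpow_swap1)
    from Suc.IH[OF this EU[OF Suc.prems(2)]] obtain w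
      where w: "w \<in> U" "w \<in> gen_eigenspace l" "eigen_shift M m w = eigen_shift M l v" by blast
    have vl: "v \<in> gen_eigenspace l" using Suc.prems(1) unfolding gen_eigenspace_def by blast
    \<comment> \<open>The shift at \<open>m\<close> is the scalar \<open>m - l\<close> plus the
      shift at \<open>l\<close>. Subtracting the \<open>w\<close> found for the shifted vector
      cancels the second part and leaves a multiple of \<open>v\<close>.\<close>
    have "eigen_shift M m v = (m - l) *s v + eigen_shift M l v"
      by (simp add: eigen_shift_eq vector_sub_rdistrib)
    hence "eigen_shift M m (v - w) = (m - l) *s v"
      using w(3) eigen_shift_add[of m "v - w" w] by simp
    hence "eigen_shift M m (inverse (m - l) *s (v - w)) = v"
      using assms(5) by (simp only: eigen_shift_scale vector_smult_assoc) simp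
    moreover have "inverse (m - l) *s (v - w) \<in> U \<inter> gen_eigenspace l"
      using w Suc.prems(2) vl
      by (auto intro!: vec.subspace_scale vec.subspace_diff U(1) subspace_gen_eigenspace)
    ultimately show ?case by blast
  qed
qed

text \<open>Independence of generalized eigenspaces: a power of the shift at \<open>m\<close>
  removes the summand at \<open>m\<close>; the induction hypothesis kills the images of the other
  summands, on whose eigenspaces that power is injective.\<close>

lemma sum_gen_eigenspaces_eq_0:
  assumes "finite S" "\<And>l. l \<in> S \<Longrightarrow> c l \<in> gen_eigenspace l" "(\<Sum>l\<in>S. c l) = 0" "l \<in> S"
  shows "c l = 0"
  using assms
proof (induction S arbitrary: c l rule: finite_induct)
  case (insert m S)
  obtain k where k: "(eigen_shift M m ^^ k) (c m) = 0"
    using insert.prems(1)[of m] by (auto simp: gen_eigenspace_def)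
  have "(eigen_shift M m ^^ k) (\<Sum>l\<in>insert m S. c l) = 0" using insert.prems(2) by simp
  hence "(\<Sum>l\<in>S. (eigen_shift M m ^^ k) (c l)) = 0"
    using insert.hyps k by (simp add: eigen_shift_pow_add eigen_shift_pow_sum)
  hence *: "(eigen_shift M m ^^ k) (c l) = 0" if "l \<in> S" for l
    using insert.IH[of "\<lambda>l. (eigen_shift M m ^^ k) (c l)"] insert.prems(1) that
      eigen_shift_pow_in_gen_eigenspace by blast
  have "c l = 0" if "l \<in> S" for l
    using eigen_shift_pow_inj_on_gen_eigenspace[OF insert.prems(1) *[OF that]] that insert.hyps
    by blast
  thus ?case using insert.prems(2,3) insert.hyps by auto
qed simp

text \<open>The summands are required to lie in \<open>U\<close>; this is how components of a vector
  of an invariant subspace turn out to stay in it.\<close>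

definition gen_eigen_spanned where
  "gen_eigen_spanned U v \<longleftrightarrow> (\<exists>S c. finite S \<and> (\<forall>l\<in>S. c l \<in> U \<inter> gen_eigenspace l) \<and> v = (\<Sum>l\<in>S. c l))"

text \<open>The summands of the shifted vector at eigenvalues other than \<open>m\<close> have
  preimages under the shift inside \<open>U\<close>. Subtracting these from \<open>v\<close> leaves
  a vector whose shift lies in the generalized eigenspace of \<open>m\<close>, hence so does the
  vector.\<close>

lemma gen_eigen_spanned_of_eigen_shift:
  assumes U: "vec.subspace U" "\<And>v. v \<in> U \<Longrightarrow> M *v v \<in> U"
    and v: "v \<in> U" "gen_eigen_spanned U (eigen_shift M m v)"
  shows "gen_eigen_spanned U v"
proof -
  obtain S c where S: "finite S" "\<And>l. l \<in> S \<Longrightarrow> c l \<in> U" "\<And>l. l \<in> S \<Longrightarrow> c l \<in> gen_eigenspace l"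
    and sum: "eigen_shift M m v = (\<Sum>l\<in>S. c l)"
    using v(2) unfolding gen_eigen_spanned_def by auto
  have "\<exists>u\<in>U \<inter> gen_eigenspace l. eigen_shift M m u = c l" if "l \<in> S - {m}" for l
    using eigen_shift_surj_on_gen_eigenspace[OF U S(2,3)] that by auto
  then obtain d where d: "\<And>l. l \<in> S - {m} \<Longrightarrow> d l \<in> U \<inter> gen_eigenspace l"
    "\<And>l. l \<in> S - {m} \<Longrightarrow> eigen_shift M m (d l) = c l" by metis
  define w where "w = v - (\<Sum>l\<in>S - {m}. d l)"
  have wU: "w \<in> U"
    unfolding w_def using d(1) v(1) U(1) by (intro vec.subspace_diff vec.subspace_sum) auto
  have "eigen_shift M m v = eigen_shift M m w + (\<Sum>l\<in>S - {m}. eigen_shift M m (d l))"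
    using eigen_shift_add[of m w "\<Sum>l\<in>S - {m}. d l"] eigen_shift_pow_sum[where l = m and k = 1 and f = d and S = "S - {m}"]
    by (simp add: w_def)
  also have "(\<Sum>l\<in>S - {m}. eigen_shift M m (d l)) = (\<Sum>l\<in>S - {m}. c l)" using d(2) by simp
  finally have "eigen_shift M m w = (\<Sum>l\<in>S. c l) - (\<Sum>l\<in>S - {m}. c l)" using sum by simp
  hence "eigen_shift M m w = (if m \<in> S then c m else 0)"
    using S(1) by (auto simp: sum_diff1)
  hence "eigen_shift M m w \<in> gen_eigenspace m"
    using S(3) vec.subspace_0[OF subspace_gen_eigenspace] by auto
  then obtain k where "(eigen_shift M m ^^ k) (eigen_shift M m w) = 0" by (auto simp: gen_eigenspace_def)
  hence "(eigen_shift M m ^^ Suc k) w = 0" by (simp add: funpow_swap1)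
  hence wm: "w \<in> gen_eigenspace m" unfolding gen_eigenspace_def by blast
  let ?e = "\<lambda>l. if l = m then w else d l"
  have "(\<Sum>l\<in>S - {m}. ?e l) = (\<Sum>l\<in>S - {m}. d l)" by (intro sum.cong) auto
  hence "v = (\<Sum>l\<in>insert m (S - {m}). ?e l)"
    using S(1) by (subst sum.insert) (auto simp: w_def)
  moreover have "\<forall>l\<in>insert m (S - {m}). ?e l \<in> U \<inter> gen_eigenspace l"
    using d(1) wU wm by auto
  ultimately show ?thesis
    unfolding gen_eigen_spanned_def using S(1) by (intro exI[of _ "insert m (S - {m})"] exI[of _ ?e]) auto
qed

section \<open>Polynomials in the matrix and annihilation of a vector\<close>

definition matrix_poly :: "complex poly \<Rightarrow> complex^'n \<Rightarrow> complex^'n" where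
  "matrix_poly p v = fold_coeffs (\<lambda>a w. a *s v + M *v w) p 0"

lemma matrix_poly_0 [simp]: "matrix_poly 0 v = 0"
  by (simp add: matrix_poly_def)

lemma matrix_poly_pCons [simp]: "matrix_poly (pCons a p) v = a *s v + M *v matrix_poly p v"
  by (cases "a = 0 \<and> p = 0") (auto simp: matrix_poly_def)

lemma matrix_poly_add: "matrix_poly (p + q) v = matrix_poly p v + matrix_poly q v"
  by (induction p q rule: poly_induct2)
    (auto simp: matrix_vector_right_distrib vector_sadd_rdistrib)

lemma matrix_poly_smult: "matrix_poly (Polynomial.smult a p) v = a *s matrix_poly p v"
  by (induction p) (auto simp: vector_scalar_commute vector_add_ldistrib vector_smult_assoc)

text \<open>The sign appears because \<open>eigen_shift\<close> is \<open>a\<close> minus the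
  matrix, whereas the linear factor is the indeterminate minus \<open>a\<close>.\<close>

lemma matrix_poly_linear_factor:
  "matrix_poly ([:- a, 1:] * p) v = - eigen_shift M a (matrix_poly p v)"
proof -
  have "[:- a, 1:] * p = Polynomial.smult (- a) p + pCons 0 p" by simp
  thus ?thesis
    by (simp only: matrix_poly_add matrix_poly_smult matrix_poly_pCons eigen_shift_eq) simp
qed

lemma matrix_poly_monom: "matrix_poly (Polynomial.monom a i) v = a *s ((*v) M ^^ i) v"
  by (induction i) (auto simp: monom_0 monom_Suc vector_scalar_commute)

lemma matrix_poly_sum: "matrix_poly (sum f S) v = (\<Sum>i\<in>S. matrix_poly (f i) v)"
  by (induction S rule: infinite_finite_induct) (auto simp: matrix_poly_add)

text \<open>The first \<open>CARD('n) + 1\<close> vectors of the orbit of \<open>v\<close> satisfy a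
  linear relation, whose coefficients form the polynomial.\<close>

lemma ex_annihilating_poly: "\<exists>p. p \<noteq> 0 \<and> matrix_poly p v = 0"
proof -
  define f where "f i = ((*v) M ^^ i) v" for i
  let ?N = "CARD('n)"
  \<comment> \<open>A repetition in the orbit would be lost in the image set, so it is treated
    apart: \<open>f i = f j\<close> gives the difference of two monomials.\<close>
  show ?thesis
  proof (cases "inj_on f {..?N}")
    case False
    then obtain i j where ij: "f i = f j" "i \<noteq> j" by (auto simp: inj_on_def)
    let ?p = "Polynomial.monom 1 i + Polynomial.monom (-1) j :: complex poly"
    have "coeff ?p i = 1" using ij(2) by simp
    hence "?p \<noteq> 0" by (metis coeff_0 zero_neq_one)
    moreover have "matrix_poly ?p v = 0"
      using ij(1) by (simp add: matrix_poly_add matrix_poly_monom f_def)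
    ultimately show ?thesis by blast
  next
    case True
    have "\<not> vec.independent (f ` {..?N})"
    proof
      assume "vec.independent (f ` {..?N})"
      hence "card (f ` {..?N}) \<le> ?N"
        using vec.independent_card_le_dim[OF subset_UNIV] by (simp only: vec_dim_card)
      thus False using card_image[OF True] by simp
    qed
    then obtain u i where u: "(\<Sum>w\<in>f ` {..?N}. u w *s w) = 0" "i \<le> ?N" "u (f i) \<noteq> 0"
      by (auto simp: vec.dependent_finite)
    let ?p = "\<Sum>i\<le>?N. Polynomial.monom (u (f i)) i"
    have "coeff ?p i = u (f i)"
      using u(2) by (simp add: coeff_sum)
    hence "?p \<noteq> 0" using u(3) by (metis coeff_0)
    moreover have "matrix_poly ?p v = 0"
      using u(1) by (simp add: matrix_poly_sum matrix_poly_monom sum.reindex[OF True] o_def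
          flip: f_def)
    ultimately show ?thesis by blast
  qed
qed

lemma gen_eigen_spanned_uminus: "vec.subspace U \<Longrightarrow> gen_eigen_spanned U (- v) \<Longrightarrow> gen_eigen_spanned U v"
  unfolding gen_eigen_spanned_def
proof (elim exE conjE)
  fix S c assume U: "vec.subspace U" and S: "finite S" "\<forall>l\<in>S. c l \<in> U \<inter> gen_eigenspace l"
    and v: "- v = (\<Sum>l\<in>S. c l)"
  have "v = (\<Sum>l\<in>S. - c l)" using v by (simp add: sum_negf) (metis minus_minus)
  moreover have "\<forall>l\<in>S. - c l \<in> U \<inter> gen_eigenspace l"
    using S(2) U subspace_gen_eigenspace by (auto intro: vec.subspace_neg)
  ultimately show "\<exists>S c. finite S \<and> (\<forall>l\<in>S. c l \<in> U \<inter> gen_eigenspace l) \<and> v = (\<Sum>l\<in>S. c l)"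
    using S(1) by (intro exI[of _ S] exI[of _ "\<lambda>l. - c l"]) auto
qed

text \<open>An annihilating polynomial splits into linear factors over the complex numbers. Its
  value at \<open>v\<close> is zero and thus spanned; removing one factor after the other carries
  this back to \<open>v\<close>.\<close>

lemma gen_eigen_spanned_invariant:
  assumes U: "vec.subspace U" "\<And>v. v \<in> U \<Longrightarrow> M *v v \<in> U" and v: "v \<in> U"
  shows "gen_eigen_spanned U v"
proof -
  \<comment> \<open>Membership in \<open>U\<close> is part of the induction because the removal of a
    shift needs its argument in \<open>U\<close>.\<close>
  have step: "matrix_poly (\<Prod>a\<leftarrow>as. [:- a, 1:]) v \<in> U
    \<and> (gen_eigen_spanned U (matrix_poly (\<Prod>a\<leftarrow>as. [:- a, 1:]) v) \<longrightarrow> gen_eigen_spanned U v)" for as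
  proof (induction as)
    case (Cons a as)
    let ?w = "matrix_poly (\<Prod>a\<leftarrow>as. [:- a, 1:]) v"
    have "eigen_shift M a ?w \<in> U"
      unfolding eigen_shift_eq using Cons.IH U by (intro vec.subspace_diff vec.subspace_scale) auto
    moreover have "gen_eigen_spanned U v" if "gen_eigen_spanned U (- eigen_shift M a ?w)"
      using gen_eigen_spanned_of_eigen_shift[OF U] gen_eigen_spanned_uminus[OF U(1) that] Cons.IH by blast
    ultimately show ?case
      using vec.subspace_neg[OF U(1)]
      unfolding list.map prod_list.Cons matrix_poly_linear_factor by blast
  qed (use v in \<open>simp add: one_pCons\<close>)
  obtain p where p: "p \<noteq> 0" "matrix_poly p v = 0"
    using ex_annihilating_poly by blast
  obtain as where as: "Polynomial.smult (lead_coeff p) (\<Prod>a\<leftarrow>as. [:- a, 1:]) = p"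
    using fundamental_theorem_algebra_factorized by blast
  have "lead_coeff p *s matrix_poly (\<Prod>a\<leftarrow>as. [:- a, 1:]) v = 0"
    using p(2) by (subst (asm) as[symmetric]) (simp only: matrix_poly_smult)
  hence "matrix_poly (\<Prod>a\<leftarrow>as. [:- a, 1:]) v = 0"
    using p(1) by (simp add: vec.scale_eq_0_iff)
  moreover have "gen_eigen_spanned U 0"
    unfolding gen_eigen_spanned_def by (intro exI[of _ "{}"]) auto
  ultimately show ?thesis using step[of as] by simp
qed

section \<open>Components of a vector and their linearity\<close>

lemma gen_eigenvector_iff: "gen_eigenvector M l v \<longleftrightarrow> v \<noteq> 0 \<and> v \<in> gen_eigenspace l"
proof -
  have "\<exists>k>0. (eigen_shift M l ^^ k) v = 0" if "(eigen_shift M l ^^ k) v = 0" for k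
    using eigen_shift_pow_mono[where k = k and j = "Suc k", OF that] by (intro exI[of _ "Suc k"]) auto
  thus ?thesis unfolding gen_eigenvector_def gen_eigenspace_def by auto
qed

lemma gen_eigen_decomposition_unique:
  assumes "gen_eigen_decomposition M v c" "gen_eigen_decomposition M v d"
  shows "c = d"
proof
  fix l
  let ?S = "{l. c l \<noteq> 0} \<union> {l. d l \<noteq> 0}"
  have fin: "finite ?S" using assms by (auto simp: gen_eigen_decomposition_def)
  have sum: "(\<Sum>l | f l \<noteq> 0. f l) = (\<Sum>l\<in>?S. f l)" if "f = c \<or> f = d" for f
    using that fin by (intro sum.mono_neutral_left) auto
  have gen: "f l \<in> gen_eigenspace l" if "f = c \<or> f = d" for f l
    using that assms vec.subspace_0[OF subspace_gen_eigenspace]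
    by (cases "f l = 0") (auto simp: gen_eigen_decomposition_def gen_eigenvector_iff)
  have "(\<Sum>l\<in>?S. c l - d l) = 0"
    using assms sum[of c] sum[of d] by (auto simp: gen_eigen_decomposition_def sum_subtractf)
  hence "c l - d l = 0" if "l \<in> ?S"
    using sum_gen_eigenspaces_eq_0[OF fin _ _ that, of "\<lambda>l. c l - d l"] gen
      vec.subspace_diff[OF subspace_gen_eigenspace] by blast
  moreover have "c l = d l" if "l \<notin> ?S" using that by auto
  ultimately show "c l = d l" by fastforce
qed

lemma gen_eigen_component_eqI:
  assumes "gen_eigen_decomposition M v c"
  shows "gen_eigen_component M v = c"
  unfolding gen_eigen_component_def
  using assms gen_eigen_decomposition_unique by blast

text \<open>\<open>S\<close> may exceed the support of \<open>c\<close>, so that a common index set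
  can serve several vectors, as in the additivity of components.\<close>

lemma gen_eigen_component_eq_sumI:
  assumes S: "finite S" "\<And>l. c l \<in> gen_eigenspace l" "\<And>l. l \<notin> S \<Longrightarrow> c l = 0"
    and v: "v = (\<Sum>l\<in>S. c l)"
  shows "gen_eigen_component M v = c"
proof (rule gen_eigen_component_eqI)
  have sub: "{l. c l \<noteq> 0} \<subseteq> S" using S(3) by blast
  have "(\<Sum>l | c l \<noteq> 0. c l) = (\<Sum>l\<in>S. c l)"
    using sub S(1) by (intro sum.mono_neutral_left) auto
  thus "gen_eigen_decomposition M v c"
    using finite_subset[OF sub S(1)] S(2) v
    by (auto simp: gen_eigen_decomposition_def gen_eigenvector_iff)
qed

lemma ex_gen_eigen_decomposition:
  assumes U: "vec.subspace U" "\<And>v. v \<in> U \<Longrightarrow> M *v v \<in> U" and v: "v \<in> U"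
  shows "\<exists>c. gen_eigen_decomposition M v c \<and> (\<forall>l. c l \<in> U)"
proof -
  obtain S c where S: "finite S" "\<forall>l\<in>S. c l \<in> U \<inter> gen_eigenspace l" "v = (\<Sum>l\<in>S. c l)"
    using gen_eigen_spanned_invariant[OF assms] unfolding gen_eigen_spanned_def by blast
  define d where "d l = (if l \<in> S then c l else 0)" for l
  have sub: "{l. d l \<noteq> 0} \<subseteq> S" by (auto simp: d_def)
  have "(\<Sum>l | d l \<noteq> 0. d l) = (\<Sum>l\<in>S. d l)"
    using sub S(1) by (intro sum.mono_neutral_left) auto
  also have "\<dots> = v" using S(3) by (simp add: d_def)
  finally have "gen_eigen_decomposition M v d"
    using finite_subset[OF sub S(1)] S(2)
    by (auto simp: gen_eigen_decomposition_def gen_eigenvector_iff d_def)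
  moreover have "\<forall>l. d l \<in> U"
    using S(2) vec.subspace_0[OF U(1)] by (auto simp: d_def)
  ultimately show ?thesis by blast
qed

lemma gen_eigen_component_works: "gen_eigen_decomposition M v (gen_eigen_component M v)"
  using ex_gen_eigen_decomposition[OF vec.subspace_UNIV, of v] gen_eigen_component_eqI by auto

text \<open>By uniqueness, the decomposition constructed inside \<open>U\<close> is the one in the
  whole space.\<close>

lemma gen_eigen_component_in_invariant:
  assumes U: "vec.subspace U" "\<And>v. v \<in> U \<Longrightarrow> M *v v \<in> U" and v: "v \<in> U"
  shows "gen_eigen_component M v l \<in> U"
  using ex_gen_eigen_decomposition[OF assms] gen_eigen_component_eqI by auto

lemma finite_gen_eigen_component: "finite {l. gen_eigen_component M v l \<noteq> 0}"
  using gen_eigen_component_works unfolding gen_eigen_decomposition_def by blast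

lemma sum_gen_eigen_component:
  assumes "finite S" "{l. gen_eigen_component M v l \<noteq> 0} \<subseteq> S"
  shows "(\<Sum>l\<in>S. gen_eigen_component M v l) = v"
proof -
  have "v = (\<Sum>l | gen_eigen_component M v l \<noteq> 0. gen_eigen_component M v l)"
    using gen_eigen_component_works unfolding gen_eigen_decomposition_def by blast
  also have "\<dots> = (\<Sum>l\<in>S. gen_eigen_component M v l)"
    using assms by (intro sum.mono_neutral_left) auto
  finally show ?thesis by simp
qed

lemma gen_eigen_component_in_gen_eigenspace: "gen_eigen_component M v l \<in> gen_eigenspace l"
  using gen_eigen_component_works[of v] vec.subspace_0[OF subspace_gen_eigenspace]
  by (cases "gen_eigen_component M v l = 0")
    (auto simp: gen_eigen_decomposition_def gen_eigenvector_iff)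

lemma gen_eigen_component_add:
  "gen_eigen_component M (u + v) l = gen_eigen_component M u l + gen_eigen_component M v l"
proof -
  let ?S = "{l. gen_eigen_component M u l \<noteq> 0} \<union> {l. gen_eigen_component M v l \<noteq> 0}"
  have "finite ?S" by (simp add: finite_gen_eigen_component)
  moreover from this have "u + v = (\<Sum>l\<in>?S. gen_eigen_component M u l + gen_eigen_component M v l)"
    by (simp add: sum.distrib sum_gen_eigen_component)
  ultimately have "gen_eigen_component M (u + v)
      = (\<lambda>l. gen_eigen_component M u l + gen_eigen_component M v l)"
    by (intro gen_eigen_component_eq_sumI[of ?S])
      (auto intro: vec.subspace_add subspace_gen_eigenspace gen_eigen_component_in_gen_eigenspace)
  thus ?thesis by simp
qed

lemma gen_eigen_component_scale:
  "gen_eigen_component M (a *s v) l = a *s gen_eigen_component M v l"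
proof -
  let ?S = "{l. gen_eigen_component M v l \<noteq> 0}"
  have "a *s v = (\<Sum>l\<in>?S. a *s gen_eigen_component M v l)"
    by (simp add: vec.scale_sum_right[symmetric] sum_gen_eigen_component finite_gen_eigen_component)
  hence "gen_eigen_component M (a *s v) = (\<lambda>l. a *s gen_eigen_component M v l)"
    by (intro gen_eigen_component_eq_sumI[of ?S])
      (auto intro: vec.subspace_scale subspace_gen_eigenspace gen_eigen_component_in_gen_eigenspace
        finite_gen_eigen_component)
  thus ?thesis by simp
qed

lemma gen_eigen_component_zero: "gen_eigen_component M 0 l = 0"
  using gen_eigen_component_scale[of 0 0] by simp

lemma gen_eigen_component_of_gen_eigenspace:
  assumes "v \<in> gen_eigenspace l"
  shows "gen_eigen_component M v l = v"
proof -
  have "gen_eigen_component M v = (\<lambda>m. if m = l then v else 0)"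
    using assms vec.subspace_0[OF subspace_gen_eigenspace]
    by (intro gen_eigen_component_eq_sumI[of "{l}"]) auto
  thus ?thesis by simp
qed

end

section \<open>Generating functions of moments\<close>

text \<open>Summing the recursion bounds \<open>1 - q\<close> times each partial sum of
  \<open>a\<close> by \<open>a 0\<close> plus the total of \<open>b\<close>.\<close>

lemma summable_of_contracting_recursion:
  fixes a b :: "nat \<Rightarrow> real"
  assumes nonneg: "\<And>k. 0 \<le> a k" "\<And>k. 0 \<le> b k" and b: "summable b"
    and q: "q < 1" and rec: "\<And>k. a (Suc k) \<le> q * a k + b k"
  shows "summable a"
proof (rule summableI_nonneg_bounded)
  fix n
  have "(\<Sum>k<n. a k) \<le> (\<Sum>k<Suc n. a k)" using nonneg by simp
  also have "\<dots> = a 0 + (\<Sum>k<n. a (Suc k))" by (rule sum.lessThan_Suc_shift)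
  also have "\<dots> \<le> a 0 + (q * (\<Sum>k<n. a k) + (\<Sum>k<n. b k))"
    using sum_mono[of "{..<n}" "\<lambda>k. a (Suc k)" "\<lambda>k. q * a k + b k"] rec
    by (simp add: sum.distrib sum_distrib_left)
  also have "(\<Sum>k<n. b k) \<le> suminf b" using nonneg b by (intro sum_le_suminf) auto
  finally have "(1 - q) * (\<Sum>k<n. a k) \<le> a 0 + suminf b" by (simp add: algebra_simps)
  thus "(\<Sum>k<n. a k) \<le> (a 0 + suminf b) / (1 - q)"
    using q by (simp add: field_simps)
qed (rule nonneg)

lemma eventually_at_left_1: "\<forall>\<^sub>F t in at_left (1::real). 0 < t \<and> t < 1"
  using eventually_at_left[of 0 "1::real"] by (auto intro: exI[of _ 0])

lemma norm_radial:
  fixes l m :: complex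
  assumes "0 < t" "t < 1" "l \<noteq> 0" "norm m \<le> norm l"
  shows "norm (of_real t / l) * norm m < 1"
proof -
  have "t * norm m \<le> t * norm l" using assms by simp
  also have "\<dots> < 1 * norm l" using assms by (intro mult_strict_right_mono) auto
  finally show ?thesis using assms by (simp add: norm_divide field_simps)
qed

lemma tendsto_radial: "l \<noteq> 0 \<Longrightarrow> ((\<lambda>t. of_real t / l) \<longlongrightarrow> 1 / l) (at_left (1::real))" for l :: complex
  by (intro tendsto_eq_intros tendsto_ident_at refl | simp)+

lemma tendsto_1_minus: "((\<lambda>t. 1 - of_real t) \<longlongrightarrow> (0::complex)) (at_left (1::real))"
  by (intro tendsto_eq_intros tendsto_ident_at refl | simp)+

text \<open>The generating function \<open>\<Sum>k. z ^ k * \<phi> (M ^ k v)\<close> of a vector \<open>v\<close> in this subspace is holomorphic for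
  \<open>norm z < 1 / norm l\<close> and has at \<open>1 / l\<close> a pole of order at most \<open>m\<close>.\<close>

definition dominated_by_pole :: "complex^'n^'n \<Rightarrow> complex \<Rightarrow> nat \<Rightarrow> (complex^'n) set" where
  "dominated_by_pole M l m = vec.span
     {v. \<exists>\<mu> k. norm \<mu> \<le> norm l \<and> (\<mu> = l \<longrightarrow> k \<le> m) \<and> (eigen_shift M \<mu> ^^ k) v = 0}"

context
  fixes M :: "complex^'n^'n" and \<phi> :: "complex^'n \<Rightarrow> complex"
  assumes phi_add: "\<And>u v. \<phi> (u + v) = \<phi> u + \<phi> v"
    and phi_scale: "\<And>a v. \<phi> (a *s v) = a * \<phi> v"
begin

definition moment :: "nat \<Rightarrow> complex^'n \<Rightarrow> complex" where
  "moment k v = \<phi> (((*v) M ^^ k) v)"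

lemma moment_add: "moment k (u + v) = moment k u + moment k v"
proof -
  have "((*v) M ^^ k) (u + v) = ((*v) M ^^ k) u + ((*v) M ^^ k) v"
    by (induction k) (auto simp: matrix_vector_right_distrib)
  thus ?thesis by (simp add: moment_def phi_add)
qed

lemma moment_scale: "moment k (a *s v) = a * moment k v"
proof -
  have "((*v) M ^^ k) (a *s v) = a *s ((*v) M ^^ k) v"
    by (induction k) (auto simp: vector_scalar_commute)
  thus ?thesis by (simp add: moment_def phi_scale)
qed

lemma moment_zero: "moment k 0 = 0"
  using moment_scale[of k 0 0] by simp

lemma moment_0: "moment 0 v = \<phi> v"
  by (simp add: moment_def)

text \<open>Any \<open>l\<close> is allowed; at the eigenvalue of a generalized eigenvector
  \<open>v\<close> the correction term comes from a vector of smaller order, which drives the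
  inductions below.\<close>

lemma moment_Suc: "moment (Suc k) v = l * moment k v - moment k (eigen_shift M l v)"
proof -
  have "l *s v = M *v v + eigen_shift M l v" by (simp add: eigen_shift_eq)
  hence "l * moment k v = moment k (M *v v) + moment k (eigen_shift M l v)"
    by (metis moment_add moment_scale)
  thus ?thesis by (simp add: moment_def funpow_swap1)
qed

text \<open>Induction on the exponent: the recursion contracts by \<open>norm z * norm l\<close>,
  and its perturbation is summable since the shifted vector needs one power less.\<close>

lemma summable_moment:
  assumes "(eigen_shift M l ^^ m) v = 0" and z: "norm z * norm l < 1"
  shows "summable (\<lambda>k. norm (z ^ k * moment k v))"
  using assms(1)
proof (induction m arbitrary: v)
  case 0
  thus ?case by (simp add: moment_zero)
next
  case (Suc m)
  show ?case
  proof (rule summable_of_contracting_recursion[OF _ _ _ z])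
    have "(eigen_shift M l ^^ m) (eigen_shift M l v) = 0"
      using Suc.prems by (simp add: funpow_swap1)
    from summable_mult[OF Suc.IH[OF this]]
    show "summable (\<lambda>k. norm z * norm (z ^ k * moment k (eigen_shift M l v)))" .
    fix k
    have "z ^ Suc k * moment (Suc k) v
        = (z * l) * (z ^ k * moment k v) - z * (z ^ k * moment k (eigen_shift M l v))"
      by (simp add: moment_Suc[of k v l] algebra_simps)
    thus "norm (z ^ Suc k * moment (Suc k) v) \<le> norm z * norm l * norm (z ^ k * moment k v)
        + norm z * norm (z ^ k * moment k (eigen_shift M l v))"
      by (metis norm_mult norm_triangle_ineq4)
  qed auto
qed

definition genfun :: "complex \<Rightarrow> complex^'n \<Rightarrow> complex" where
  "genfun z v = (\<Sum>k. z ^ k * moment k v)"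

lemma genfun_zero [simp]: "genfun z 0 = 0"
  by (simp add: genfun_def moment_zero)

text \<open>\<open>genfun z v\<close> stands for \<phi> applied to the inverse of I - zM at
  \<open>v\<close>. This resolvent equation trades a division by \<open>1 - z * l\<close> for a
  lower order of the vector.\<close>

lemma genfun_eigen_shift:
  assumes v: "(eigen_shift M l ^^ m) v = 0" and z: "norm z * norm l < 1"
  shows "(1 - z * l) * genfun z v = \<phi> v - z * genfun z (eigen_shift M l v)"
proof -
  have Ev: "(eigen_shift M l ^^ m) (eigen_shift M l v) = 0"
    using v by (metis eigen_shift_pow_commute eigen_shift_zero)
  note s = summable_norm_cancel[OF summable_moment[OF v z]]
  note s' = summable_norm_cancel[OF summable_moment[OF Ev z]]
  have "genfun z v = \<phi> v + (\<Sum>k. z ^ Suc k * moment (Suc k) v)"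
    unfolding genfun_def using suminf_split_head[OF s] by (simp add: moment_0)
  also have "(\<Sum>k. z ^ Suc k * moment (Suc k) v)
      = (\<Sum>k. (z * l) * (z ^ k * moment k v) - z * (z ^ k * moment k (eigen_shift M l v)))"
    by (simp add: moment_Suc[of _ v l] algebra_simps)
  also have "\<dots> = (z * l) * genfun z v - z * genfun z (eigen_shift M l v)"
    unfolding genfun_def
    using suminf_diff[OF summable_mult[OF s] summable_mult[OF s']] suminf_mult[OF s] suminf_mult[OF s']
    by simp
  finally show ?thesis by (simp add: algebra_simps)
qed

text \<open>Each use of the functional equation divides by \<open>1 - z * m\<close>, which has the
  nonzero limit \<open>1 - m / l\<close> at the point \<open>1 / l\<close>.\<close>

lemma genfun_converges_off_pole:
  assumes "(eigen_shift M m ^^ k) v = 0" and l: "l \<noteq> 0" "norm m \<le> norm l" "m \<noteq> l"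
  shows "\<exists>L. ((\<lambda>t. genfun (of_real t / l) v) \<longlongrightarrow> L) (at_left (1::real))"
  using assms(1)
proof (induction k arbitrary: v)
  case (Suc k)
  have "(eigen_shift M m ^^ k) (eigen_shift M m v) = 0"
    using Suc.prems by (simp add: funpow_swap1)
  from Suc.IH[OF this] obtain L
    where L: "((\<lambda>t. genfun (of_real t / l) (eigen_shift M m v)) \<longlongrightarrow> L) (at_left (1::real))" by blast
  have ne: "1 - 1 / l * m \<noteq> 0" using l by (simp add: field_simps)
  have "((\<lambda>t. (\<phi> v - of_real t / l * genfun (of_real t / l) (eigen_shift M m v))
      / (1 - of_real t / l * m)) \<longlongrightarrow> (\<phi> v - 1 / l * L) / (1 - 1 / l * m)) (at_left (1::real))"
    by (intro tendsto_intros tendsto_radial[OF l(1)] L ne)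
  moreover have "\<forall>\<^sub>F t in at_left (1::real). (\<phi> v - of_real t / l * genfun (of_real t / l) (eigen_shift M m v))
      / (1 - of_real t / l * m) = genfun (of_real t / l) v"
    using eventually_at_left_1
  proof eventually_elim
    case (elim t)
    hence z: "norm (of_real t / l) * norm m < 1" using norm_radial l by blast
    hence "1 - of_real t / l * m \<noteq> 0" by (metis norm_mult norm_one order_less_irrefl right_minus_eq)
    thus ?case
      using genfun_eigen_shift[OF Suc.prems z] by (metis nonzero_eq_divide_eq mult.commute)
  qed
  ultimately have "((\<lambda>t. genfun (of_real t / l) v) \<longlongrightarrow> (\<phi> v - 1 / l * L) / (1 - 1 / l * m)) (at_left (1::real))"
    by (rule Lim_transform_eventually)
  thus ?case by blast
qed auto

text \<open>At \<open>z = t / l\<close> the factor \<open>1 - z * l\<close> equals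
  \<open>1 - t\<close>. Each step of the induction therefore allows one more order of the pole and
  multiplies the leading coefficient by \<open>- 1 / l\<close>, while the term
  \<open>\<phi> v\<close> affects only lower orders.\<close>

lemma genfun_pole:
  assumes "(eigen_shift M l ^^ Suc m) v = 0" and l: "l \<noteq> 0"
  shows "((\<lambda>t. (1 - of_real t) ^ Suc m * genfun (of_real t / l) v)
    \<longlongrightarrow> (- 1 / l) ^ m * \<phi> ((eigen_shift M l ^^ m) v)) (at_left (1::real))"
  using assms(1)
proof (induction m arbitrary: v)
  case 0
  have "\<forall>\<^sub>F t in at_left (1::real). \<phi> v = (1 - of_real t) ^ Suc 0 * genfun (of_real t / l) v"
    using eventually_at_left_1
  proof eventually_elim
    case (elim t)
    hence z: "norm (of_real t / l) * norm l < 1" using norm_radial l by blast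
    show ?case using genfun_eigen_shift[OF 0 z] l 0 by simp
  qed
  from Lim_transform_eventually[OF tendsto_const this] show ?case by simp
next
  case (Suc m)
  let ?Ev = "eigen_shift M l v"
  have "(eigen_shift M l ^^ Suc m) ?Ev = 0"
    using Suc.prems by (simp only: funpow_Suc_right o_apply)
  note IH = Suc.IH[OF this]
  have lim: "((\<lambda>t. (1 - of_real t) * (1 - of_real t) ^ m * \<phi> v
       - of_real t / l * ((1 - of_real t) ^ Suc m * genfun (of_real t / l) ?Ev))
     \<longlongrightarrow> 0 * 0 ^ m * \<phi> v - 1 / l * ((- 1 / l) ^ m * \<phi> ((eigen_shift M l ^^ m) ?Ev))) (at_left (1::real))"
    by (intro tendsto_intros tendsto_radial[OF l] IH tendsto_1_minus)
  have eq: "0 * 0 ^ m * \<phi> v - 1 / l * ((- 1 / l) ^ m * \<phi> ((eigen_shift M l ^^ m) ?Ev))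
      = (- 1 / l) ^ Suc m * \<phi> ((eigen_shift M l ^^ Suc m) v)"
    by (simp only: funpow_Suc_right o_apply) simp
  have ev: "\<forall>\<^sub>F t in at_left (1::real). (1 - of_real t) * (1 - of_real t) ^ m * \<phi> v
       - of_real t / l * ((1 - of_real t) ^ Suc m * genfun (of_real t / l) ?Ev)
     = (1 - of_real t) ^ Suc (Suc m) * genfun (of_real t / l) v"
    using eventually_at_left_1
  proof eventually_elim
    case (elim t)
    hence z: "norm (of_real t / l) * norm l < 1" using norm_radial l by blast
    have "(1 - of_real t) * genfun (of_real t / l) v = \<phi> v - of_real t / l * genfun (of_real t / l) ?Ev"
      using genfun_eigen_shift[OF Suc.prems z] l by simp
    moreover have "x * x ^ m * p - z * (x ^ Suc m * G') = x ^ Suc (Suc m) * G"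
      if "x * G = p - z * G'" for x z p G G' :: complex
    proof -
      have "x ^ Suc (Suc m) * G = x ^ Suc m * (x * G)" by (simp only: power_Suc mult_ac)
      also have "\<dots> = x ^ Suc m * (p - z * G')" by (simp only: that)
      finally show ?thesis by (simp add: right_diff_distrib mult_ac)
    qed
    ultimately show ?case by blast
  qed
  show ?case using Lim_transform_eventually[OF lim ev] unfolding eq .
qed

lemma summable_moment_dominated:
  assumes v: "v \<in> dominated_by_pole M l m" and z: "norm z * norm l < 1"
  shows "summable (\<lambda>k. norm (z ^ k * moment k v))"
proof -
  let ?P = "{v. summable (\<lambda>k. norm (z ^ k * moment k v))}"
  have "vec.subspace ?P"
  proof (rule vec.subspaceI; clarsimp simp: moment_zero simp del: norm_mult)
    fix u v assume "summable (\<lambda>k. norm (z ^ k * moment k u))" "summable (\<lambda>k. norm (z ^ k * moment k v))"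
    from summable_add[OF this] show "summable (\<lambda>k. norm (z ^ k * moment k (u + v)))"
      by (rule summable_comparison_test'[where N = 0])
        (simp add: moment_add distrib_left norm_triangle_ineq del: norm_mult)
  next
    fix a v assume "summable (\<lambda>k. norm (z ^ k * moment k v))"
    from summable_mult[OF this, of "norm a"] show "summable (\<lambda>k. norm (z ^ k * moment k (a *s v)))"
      by (simp add: moment_scale norm_mult mult_ac)
  qed
  moreover have "v \<in> ?P"
    if H: "norm \<mu> \<le> norm l" "(eigen_shift M \<mu> ^^ k) v = 0" for v \<mu> k
  proof -
    have "norm z * norm \<mu> < 1"
      using mult_left_mono[OF H(1), of "norm z"] z by simp
    from summable_moment[OF H(2) this] show ?thesis by simp
  qed
  ultimately have "dominated_by_pole M l m \<subseteq> ?P"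
    unfolding dominated_by_pole_def by (intro vec.span_minimal) auto
  thus ?thesis using v by auto
qed

lemma genfun_dominated:
  assumes v: "v \<in> dominated_by_pole M l m" and l: "l \<noteq> 0"
  shows "((\<lambda>t. (1 - of_real t) ^ Suc m * genfun (of_real t / l) v) \<longlongrightarrow> 0) (at_left (1::real))"
proof -
  let ?D = "dominated_by_pole M l m"
  \<comment> \<open>Membership in \<open>?D\<close> is kept in \<open>?P\<close> because additivity
    of \<open>genfun\<close> rests on the convergence of both series.\<close>
  let ?P = "{v \<in> ?D. ((\<lambda>t. (1 - of_real t) ^ Suc m * genfun (of_real t / l) v) \<longlongrightarrow> 0) (at_left (1::real))}"
  have D: "vec.subspace ?D" unfolding dominated_by_pole_def by (rule vec.subspace_span)
  have s: "summable (\<lambda>k. (of_real t / l) ^ k * moment k v)" if "0 < t" "t < 1" "v \<in> ?D" for t v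
    using summable_norm_cancel[OF summable_moment_dominated[OF that(3) norm_radial[OF that(1,2) l order_refl]]] .
  have "vec.subspace ?P"
  proof (rule vec.subspaceI)
    show "0 \<in> ?P" using vec.subspace_0[OF D] by simp
  next
    fix u v assume uv: "u \<in> ?P" "v \<in> ?P"
    have "((\<lambda>t. (1 - of_real t) ^ Suc m * genfun (of_real t / l) u
        + (1 - of_real t) ^ Suc m * genfun (of_real t / l) v) \<longlongrightarrow> 0 + 0) (at_left (1::real))"
      using uv by (intro tendsto_add) auto
    moreover have "\<forall>\<^sub>F t in at_left (1::real). (1 - of_real t) ^ Suc m * genfun (of_real t / l) u
        + (1 - of_real t) ^ Suc m * genfun (of_real t / l) v
        = (1 - of_real t) ^ Suc m * genfun (of_real t / l) (u + v)"
      using eventually_at_left_1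
    proof eventually_elim
      case (elim t)
      have "genfun (of_real t / l) (u + v) = genfun (of_real t / l) u + genfun (of_real t / l) v"
        unfolding genfun_def using suminf_add[OF s s, of t u t v] elim uv
        by (simp add: moment_add distrib_left)
      thus ?case by (simp add: distrib_left)
    qed
    ultimately have "((\<lambda>t. (1 - of_real t) ^ Suc m * genfun (of_real t / l) (u + v)) \<longlongrightarrow> 0 + 0) (at_left (1::real))"
      by (rule Lim_transform_eventually)
    thus "u + v \<in> ?P"
      using uv vec.subspace_add[OF D] by simp
  next
    fix a v assume v: "v \<in> ?P"
    have "((\<lambda>t. a * ((1 - of_real t) ^ Suc m * genfun (of_real t / l) v)) \<longlongrightarrow> a * 0) (at_left (1::real))"
      using v by (intro tendsto_mult_left) auto
    moreover have "\<forall>\<^sub>F t in at_left (1::real). a * ((1 - of_real t) ^ Suc m * genfun (of_real t / l) v)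
        = (1 - of_real t) ^ Suc m * genfun (of_real t / l) (a *s v)"
      using eventually_at_left_1
    proof eventually_elim
      case (elim t)
      have "genfun (of_real t / l) (a *s v) = a * genfun (of_real t / l) v"
        unfolding genfun_def using suminf_mult[OF s, of t v a] elim v
        by (simp add: moment_scale mult_ac)
      thus ?case by simp
    qed
    ultimately have "((\<lambda>t. (1 - of_real t) ^ Suc m * genfun (of_real t / l) (a *s v)) \<longlongrightarrow> a * 0) (at_left (1::real))"
      by (rule Lim_transform_eventually)
    thus "a *s v \<in> ?P"
      using v vec.subspace_scale[OF D] by simp
  qed
  moreover have "v \<in> ?P"
    if H: "norm \<mu> \<le> norm l" "\<mu> = l \<longrightarrow> k \<le> m" "(eigen_shift M \<mu> ^^ k) v = 0" for v \<mu> k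
  proof -
    have "v \<in> ?D"
      unfolding dominated_by_pole_def by (rule vec.span_base) (rule CollectI, intro exI conjI, (rule H)+)
    moreover have "((\<lambda>t. (1 - of_real t) ^ Suc m * genfun (of_real t / l) v) \<longlongrightarrow> 0) (at_left (1::real))"
    proof (cases "\<mu> = l")
      case False
      then obtain L where L: "((\<lambda>t. genfun (of_real t / l) v) \<longlongrightarrow> L) (at_left (1::real))"
        using genfun_converges_off_pole[OF H(3) l H(1)] by blast
      have "((\<lambda>t. (1 - of_real t) ^ Suc m * genfun (of_real t / l) v) \<longlongrightarrow> 0 ^ Suc m * L) (at_left (1::real))"
        by (intro tendsto_intros tendsto_1_minus L)
      thus ?thesis by simp
    next
      case True
      hence z: "(eigen_shift M l ^^ m) v = 0"
        using eigen_shift_pow_mono[where k = k and j = m] H by metis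
      \<comment> \<open>For \<open>m = 0\<close> the vector is zero. Otherwise its pole has order at
        most \<open>m\<close>, and the spare factor \<open>1 - t\<close> sends the product to
        \<open>0\<close>.\<close>
      show ?thesis
      proof (cases m)
        case (Suc m')
        have "((\<lambda>t. (1 - of_real t) * ((1 - of_real t) ^ Suc m' * genfun (of_real t / l) v))
          \<longlongrightarrow> 0 * ((- 1 / l) ^ m' * \<phi> ((eigen_shift M l ^^ m') v))) (at_left (1::real))"
          using z Suc by (intro tendsto_intros tendsto_1_minus genfun_pole l) auto
        thus ?thesis by (simp add: Suc mult_ac)
      qed (use z in simp)
    qed
    ultimately show ?thesis by simp
  qed
  ultimately have "vec.span {v. \<exists>\<mu> k. norm \<mu> \<le> norm l \<and> (\<mu> = l \<longrightarrow> k \<le> m) \<and> (eigen_shift M \<mu> ^^ k) v = 0} \<subseteq> ?P"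
    by (intro vec.span_minimal subsetI) (elim CollectE exE conjE, assumption+)
  thus ?thesis using v unfolding dominated_by_pole_def[symmetric] by blast
qed

text \<open>A Pringsheim-type comparison: nonnegative moments are largest along the positive axis.\<close>

lemma pole_comparison:
  assumes l: "l \<noteq> 0"
    and mom: "\<And>k. moment k u = of_real (a k)" "\<And>k. moment k w = of_real (b k)"
      "\<And>k. 0 \<le> a k" "\<And>k. a k \<le> b k"
    and u: "u = u1 + u2" "(eigen_shift M l ^^ Suc m) u1 = 0" "u2 \<in> dominated_by_pole M l 0"
    and w: "w \<in> dominated_by_pole M (of_real (norm l)) m"
  shows "\<phi> ((eigen_shift M l ^^ m) u1) = 0"
proof -
  let ?r = "of_real (norm l) :: complex"
  let ?F = "at_left (1::real)"
  have r: "?r \<noteq> 0" using l by simp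
  have u1: "u1 \<in> dominated_by_pole M l (Suc m)"
    unfolding dominated_by_pole_def by (rule vec.span_base) (use u(2) in blast)
  have "u2 \<in> dominated_by_pole M l (Suc m)"
    using u(3) vec.span_mono[of "{v. \<exists>\<mu> k. norm \<mu> \<le> norm l \<and> (\<mu> = l \<longrightarrow> k \<le> 0) \<and> (eigen_shift M \<mu> ^^ k) v = 0}"
      "{v. \<exists>\<mu> k. norm \<mu> \<le> norm l \<and> (\<mu> = l \<longrightarrow> k \<le> Suc m) \<and> (eigen_shift M \<mu> ^^ k) v = 0}"]
    unfolding dominated_by_pole_def by (auto simp: subset_iff)
  note s1 = summable_moment_dominated[OF u1] and s2 = summable_moment_dominated[OF this]
  \<comment> \<open>Termwise comparison: \<open>t / l\<close> has modulus \<open>t / norm l\<close>,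
    and the moments of \<open>u\<close> are at most those of \<open>w\<close>, so the series of
    \<open>u\<close> is bounded by that of \<open>w\<close> on the positive axis.\<close>
  have le: "\<forall>\<^sub>F t in ?F. norm ((1 - of_real t) ^ Suc m * genfun (of_real t / l) u)
      \<le> norm ((1 - of_real t) ^ Suc m * genfun (of_real t / ?r) w)"
    using eventually_at_left_1
  proof eventually_elim
    case (elim t)
    have zr: "norm (of_real t / ?r) * norm ?r < 1" using norm_radial[of t ?r ?r] elim r by simp
    have swn: "summable (\<lambda>k. norm ((of_real t / ?r) ^ k * moment k w))"
      by (rule summable_moment_dominated[OF w zr])
    have wk: "(of_real t / ?r) ^ k * moment k w = of_real ((t / norm l) ^ k * b k)" for k
      by (simp add: mom)
    have b: "0 \<le> b k" for k using mom(3,4) order_trans by blast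
    have sw: "summable (\<lambda>k. (t / norm l) ^ k * b k)"
      using swn elim b unfolding wk by (simp add: norm_mult norm_power del: of_real_mult)
    have uk: "norm ((of_real t / l) ^ k * moment k u) \<le> (t / norm l) ^ k * b k" for k
      using mom(3,4) elim by (simp add: mom norm_mult norm_power norm_divide mult_left_mono)
    have su: "summable (\<lambda>k. norm ((of_real t / l) ^ k * moment k u))"
      by (rule summable_comparison_test'[OF sw, where N = 0]) (use uk in simp)
    have "norm (genfun (of_real t / l) u) \<le> (\<Sum>k. norm ((of_real t / l) ^ k * moment k u))"
      unfolding genfun_def by (rule summable_norm[OF su])
    also have "\<dots> \<le> (\<Sum>k. (t / norm l) ^ k * b k)"
      by (rule suminf_le[OF uk su sw])
    also have "\<dots> \<le> norm (of_real (\<Sum>k. (t / norm l) ^ k * b k) :: complex)" by simp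
    also have "of_real (\<Sum>k. (t / norm l) ^ k * b k) = genfun (of_real t / ?r) w"
      unfolding genfun_def wk by (rule suminf_of_real[OF sw])
    finally show ?case by (simp add: norm_mult mult_left_mono)
  qed
  have "((\<lambda>t. (1 - of_real t) ^ Suc m * genfun (of_real t / l) u) \<longlongrightarrow> 0) ?F"
    by (rule Lim_null_comparison[OF le]) (intro tendsto_norm_zero genfun_dominated[OF w r])
  \<comment> \<open>The same expression tends to the leading coefficient of \<open>u1\<close>,
    because \<open>u2\<close> contributes nothing at this order; uniqueness of limits then makes
    that coefficient zero.\<close>
  moreover have "((\<lambda>t. (1 - of_real t) ^ Suc m * genfun (of_real t / l) u)
      \<longlongrightarrow> (- 1 / l) ^ m * \<phi> ((eigen_shift M l ^^ m) u1)) ?F"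
  proof -
    have "((\<lambda>t. (1 - of_real t) ^ m * ((1 - of_real t) ^ Suc 0 * genfun (of_real t / l) u2)) \<longlongrightarrow> 0 ^ m * 0) ?F"
      by (intro tendsto_intros tendsto_1_minus genfun_dominated u(3) l)
    hence "((\<lambda>t. (1 - of_real t) ^ Suc m * genfun (of_real t / l) u2) \<longlongrightarrow> 0) ?F"
      by (simp add: mult_ac)
    from tendsto_add[OF genfun_pole[OF u(2) l] this]
    have "((\<lambda>t. (1 - of_real t) ^ Suc m * genfun (of_real t / l) u1
        + (1 - of_real t) ^ Suc m * genfun (of_real t / l) u2)
      \<longlongrightarrow> (- 1 / l) ^ m * \<phi> ((eigen_shift M l ^^ m) u1)) ?F" by simp
    moreover have "\<forall>\<^sub>F t in ?F. (1 - of_real t) ^ Suc m * genfun (of_real t / l) u1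
        + (1 - of_real t) ^ Suc m * genfun (of_real t / l) u2
        = (1 - of_real t) ^ Suc m * genfun (of_real t / l) u"
      using eventually_at_left_1
    proof eventually_elim
      case (elim t)
      have z: "norm (of_real t / l) * norm l < 1" using norm_radial elim l by blast
      have "genfun (of_real t / l) u = genfun (of_real t / l) u1 + genfun (of_real t / l) u2"
        unfolding genfun_def u(1)
        using suminf_add[OF summable_norm_cancel[OF s1[OF z]] summable_norm_cancel[OF s2[OF z]]]
        by (simp add: moment_add distrib_left)
      thus ?case by (simp add: distrib_left)
    qed
    ultimately show ?thesis by (rule Lim_transform_eventually)
  qed
  ultimately have "0 = (- 1 / l) ^ m * \<phi> ((eigen_shift M l ^^ m) u1)"
    by (rule tendsto_unique[OF trivial_limit_at_left_real])
  thus ?thesis using l by simp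
qed

end

section \<open>Faces and the dual cone\<close>

text \<open>By pointedness one of \<open>u\<close> and \<open>- u\<close> lies outside
  \<open>K\<close>; a hyperplane separating it from the closed cone has its normal in the dual
  cone.\<close>

lemma dual_cone_separates:
  fixes K :: "'a::euclidean_space set"
  assumes K: "proper_cone K" and u: "u \<noteq> 0"
  shows "\<exists>a. (\<forall>y\<in>K. 0 \<le> inner a y) \<and> inner a u \<noteq> 0"
proof -
  have cl: "closed K" and cc: "convex_cone K" and pt: "K \<inter> uminus ` K = {0}"
    using K by (auto simp: proper_cone_def)
  have "\<exists>z\<in>{u, - u}. z \<notin> K"
  proof (rule ccontr)
    assume "\<not> ?thesis"
    hence "u \<in> K" "- u \<in> K" by auto
    moreover from this have "u \<in> uminus ` K" by (metis imageI minus_minus)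
    ultimately have "u \<in> K \<inter> uminus ` K" by blast
    thus False using pt u by blast
  qed
  then obtain z where z: "z \<in> {u, - u}" "z \<notin> K" by blast
  have "convex K" using cc by (simp add: convex_cone_def)
  from separating_hyperplane_closed_point[OF this cl z(2)] obtain a b
    where ab: "inner a z < b" "\<And>y. y \<in> K \<Longrightarrow> b < inner a y" by blast
  have b0: "b < 0" using ab(2)[OF convex_cone_contains_0[OF cc]] by simp
  have "0 \<le> inner a y" if y: "y \<in> K" for y
  proof (rule ccontr)
    assume neg: "\<not> 0 \<le> inner a y"
    \<comment> \<open>The multiple is chosen so that its inner product with \<open>a\<close> is
      exactly \<open>b\<close>, against the strict inequality for points of
      \<open>K\<close>.\<close>
    hence "(b / inner a y) *\<^sub>R y \<in> K"
      using b0 by (intro convex_cone_scaleR[OF cc]) (auto simp: zero_le_divide_iff y)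
    from ab(2)[OF this] show False using neg by simp
  qed
  moreover have "inner a u \<noteq> 0" using z(1) ab(1) b0 by auto
  ultimately show ?thesis by blast
qed

lemma cone_preserving_pow:
  assumes "A \<in> cone_preserving K" "y \<in> K"
  shows "((*v) A ^^ k) y \<in> K"
  using assms by (induction k) (auto simp: cone_preserving_def)

lemma orbit_hull_invariant:
  fixes A :: "real^'n^'n"
  assumes "w \<in> convex_cone hull (range (\<lambda>k. ((*v) A ^^ k) x))"
  shows "A *v w \<in> convex_cone hull (range (\<lambda>k. ((*v) A ^^ k) x))" (is "_ \<in> ?W")
proof -
  have "?W \<subseteq> {w. A *v w \<in> ?W}"
  proof (rule hull_minimal)
    show "range (\<lambda>k. ((*v) A ^^ k) x) \<subseteq> {w. A *v w \<in> ?W}"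
    proof clarify
      fix k
      have "A *v ((*v) A ^^ k) x = ((*v) A ^^ Suc k) x" by simp
      thus "A *v ((*v) A ^^ k) x \<in> ?W" by (metis hull_inc rangeI)
    qed
    show "convex_cone {w. A *v w \<in> ?W}"
      by (auto simp: convex_cone_iff convex_cone_hull_contains_0 matrix_vector_right_distrib
          convex_cone_hull_add convex_cone_hull_mul matrix_vector_mult_scaleR)
  qed
  thus ?thesis using assms by blast
qed

text \<open>The vectors dominated, in the order of \<open>K\<close>, by the orbit of a relative interior point form
  an invariant face.\<close>

lemma least_invariant_face_dominated:
  fixes A :: "real^'n^'n"
  assumes K: "convex_cone K" and A: "A \<in> cone_preserving K" and F: "cone_face K F"
    and x: "x \<in> rel_interior F" and g: "g \<in> least_invariant_face A K F"
  shows "\<exists>w \<in> convex_cone hull (range (\<lambda>k. ((*v) A ^^ k) x)). w - g \<in> K"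
proof -
  let ?W = "convex_cone hull (range (\<lambda>k. ((*v) A ^^ k) x))"
  define H where "H = {y \<in> K. \<exists>w\<in>?W. w - y \<in> K}"
  have FK: "F \<subseteq> K" and Fcc: "convex_cone F" using F by (auto simp: cone_face_def)
  have xF: "x \<in> F" using x rel_interior_subset by blast
  have xW: "x \<in> ?W" using hull_inc[of x "range (\<lambda>k. ((*v) A ^^ k) x)"] by (metis funpow_0 rangeI)
  have H0: "0 \<in> H"
    unfolding H_def using convex_cone_contains_0[OF K] convex_cone_hull_contains_0 by force
  have Hadd: "y + z \<in> H" if "y \<in> H" "z \<in> H" for y z
  proof -
    obtain v w where "v \<in> ?W" "v - y \<in> K" "w \<in> ?W" "w - z \<in> K"
      using \<open>y \<in> H\<close> \<open>z \<in> H\<close> unfolding H_def by blast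
    moreover from this have "(v + w) - (y + z) \<in> K"
      using convex_cone_add[OF K] by (metis add_diff_add)
    ultimately show ?thesis
      using that convex_cone_add[OF K] convex_cone_hull_add unfolding H_def by blast
  qed
  have Hscale: "c *\<^sub>R y \<in> H" if "y \<in> H" "0 \<le> c" for c y
  proof -
    obtain w where "w \<in> ?W" "w - y \<in> K" using \<open>y \<in> H\<close> unfolding H_def by blast
    moreover from this have "c *\<^sub>R w - c *\<^sub>R y \<in> K"
      using convex_cone_scaleR[OF K that(2)] by (metis scaleR_diff_right)
    ultimately show ?thesis
      using that convex_cone_scaleR[OF K] convex_cone_hull_mul unfolding H_def by blast
  qed
  have Hface: "y \<in> H" if yz: "y \<in> K" "z \<in> K" "y + z \<in> H" for y z
  proof -
    obtain w where w: "w \<in> ?W" "w - (y + z) \<in> K" using yz(3) unfolding H_def by blast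
    have "w - y = (w - (y + z)) + z" by simp
    hence "w - y \<in> K" using convex_cone_add[OF K w(2) yz(2)] by metis
    thus ?thesis using w(1) yz(1) unfolding H_def by blast
  qed
  have Hinv: "A *v y \<in> H" if "y \<in> H" for y
  proof -
    obtain w where w: "w \<in> ?W" "w - y \<in> K" using \<open>y \<in> H\<close> unfolding H_def by blast
    have "A *v w - A *v y \<in> K"
      using A w(2) by (auto simp: cone_preserving_def simp flip: matrix_vector_mult_diff_distrib)
    thus ?thesis
      using A that orbit_hull_invariant[OF w(1)] by (auto simp: H_def cone_preserving_def)
  qed
  have "F \<subseteq> H"
  proof
    fix y assume y: "y \<in> F"
    \<comment> \<open>The segment from \<open>y\<close> to the relative interior point
      \<open>x\<close> can be prolonged beyond \<open>x\<close> inside \<open>F\<close>. Dividing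
      its endpoint by \<open>e - 1\<close> gives a multiple of \<open>x\<close> minus
      \<open>y\<close>, so \<open>y\<close> is dominated by the orbit.\<close>
    obtain e where e: "e > 1" "(1 - e) *\<^sub>R y + e *\<^sub>R x \<in> F"
      using convex_rel_interior_iff[of F x] x y Fcc by (auto simp: convex_cone_def)
    have "(1 / (e - 1)) *\<^sub>R ((1 - e) *\<^sub>R y + e *\<^sub>R x) \<in> K"
      using e FK by (intro convex_cone_scaleR[OF K]) auto
    also have "(1 / (e - 1)) *\<^sub>R ((1 - e) *\<^sub>R y + e *\<^sub>R x) = (e / (e - 1)) *\<^sub>R x - y"
    proof -
      have "(1 / (e - 1)) * (1 - e) = - 1" using e(1) by (simp add: field_simps)
      thus ?thesis by (simp add: scaleR_add_right)
    qed
    finally have "(e / (e - 1)) *\<^sub>R x - y \<in> K" .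
    moreover have "(e / (e - 1)) *\<^sub>R x \<in> ?W"
      using e(1) by (intro convex_cone_hull_mul[OF xW]) simp
    moreover have "y \<in> K" using y FK by blast
    ultimately show "y \<in> H" unfolding H_def by (intro CollectI conjI bexI)
  qed
  moreover have "invariant_face A K H"
    unfolding invariant_face_def cone_face_def convex_cone_iff
  proof (intro conjI ballI allI impI)
    show "H \<subseteq> K" by (auto simp: H_def)
    show "y \<in> H" "z \<in> H" if "y \<in> K" "z \<in> K" "y + z \<in> H" for y z
      using Hface[of y z] Hface[of z y] that by (auto simp: add.commute)
    show "(*v) A ` H \<subseteq> H" using Hinv by blast
  qed (fact H0 | rule Hadd Hscale; assumption)+
  ultimately have "least_invariant_face A K F \<subseteq> H"
    using least_invariant_face_works(1)[OF K A FK] by blast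
  thus ?thesis using g unfolding H_def by blast
qed

section \<open>Complexification and real functionals\<close>

lemma complex_vec_nth [simp]: "complex_vec x $ i = complex_of_real (x $ i)"
  by (simp add: complex_vec_def)

lemma complex_vec_eq_0_iff [simp]: "complex_vec x = 0 \<longleftrightarrow> x = 0"
  by (simp add: Finite_Cartesian_Product.vec_eq_iff)

lemma complex_vec_0 [simp]: "complex_vec 0 = 0"
  by simp

lemma complex_vec_add: "complex_vec (x + y) = complex_vec x + complex_vec y"
  by (simp add: Finite_Cartesian_Product.vec_eq_iff)

lemma complex_vec_scale: "complex_vec (c *\<^sub>R x) = complex_of_real c *s complex_vec x"
  by (simp add: Finite_Cartesian_Product.vec_eq_iff)

lemma complex_vec_sum: "complex_vec (sum f S) = (\<Sum>i\<in>S. complex_vec (f i))"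
  by (simp add: Finite_Cartesian_Product.vec_eq_iff)

lemma map_matrix_complex_vec: "map_matrix complex_of_real A *v complex_vec x = complex_vec (A *v x)"
  by (simp add: Finite_Cartesian_Product.vec_eq_iff matrix_vector_mult_def map_matrix_def)

lemma map_matrix_pow_complex_vec:
  fixes A :: "real^'n^'n"
  shows "((*v) (map_matrix complex_of_real A) ^^ k) (complex_vec x) = complex_vec (((*v) A ^^ k) x)"
  by (induction k) (auto simp: map_matrix_complex_vec)

text \<open>The complex-linear extension of \<open>inner a\<close>; no conjugation occurs, as \<phi>
  in the moment estimates has to be linear.\<close>

definition real_functional :: "real^'n \<Rightarrow> complex^'n \<Rightarrow> complex" where
  "real_functional a v = (\<Sum>i\<in>UNIV. complex_of_real (a $ i) * v $ i)"

lemma real_functional_add: "real_functional a (u + v) = real_functional a u + real_functional a v"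
  by (simp add: real_functional_def distrib_left sum.distrib)

lemma real_functional_scale: "real_functional a (c *s v) = c * real_functional a v"
  by (simp add: real_functional_def sum_distrib_left mult_ac)

lemma real_functional_complex_vec: "real_functional a (complex_vec x) = complex_of_real (inner a x)"
  by (simp add: real_functional_def inner_vec_def)

text \<open>As \<open>a\<close> is real, the real and imaginary parts of \<open>v\<close> are tested
  separately, and the dual cone separates each of them from \<open>0\<close>.\<close>

lemma real_functional_separates:
  fixes v :: "complex^'n"
  assumes K: "proper_cone K" and v: "\<And>a. (\<forall>y\<in>K. 0 \<le> inner a y) \<Longrightarrow> real_functional a v = 0"
  shows "v = 0"
proof -
  let ?re = "\<chi> i. Re (v $ i)" and ?im = "\<chi> i. Im (v $ i)"
  have "Re (real_functional a v) = inner a ?re" "Im (real_functional a v) = inner a ?im" for a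
    by (simp_all add: real_functional_def inner_vec_def)
  hence "inner a ?re = 0" "inner a ?im = 0" if "\<forall>y\<in>K. 0 \<le> inner a y" for a
    using v[OF that] by (metis zero_complex.simps)+
  hence "?re = 0" "?im = 0" using dual_cone_separates[OF K] by blast+
  thus ?thesis by (simp add: Finite_Cartesian_Product.vec_eq_iff complex_eq_iff)
qed

section \<open>Dominance at the spectral radius\<close>

lemma dominated_by_poleI:
  assumes fin: "\<And>\<mu>. gen_eigen_component M v \<mu> \<noteq> 0 \<Longrightarrow> norm \<mu> \<le> norm l"
    and l: "(eigen_shift M l ^^ m) (gen_eigen_component M v l) = 0"
  shows "v \<in> dominated_by_pole M l m"
proof -
  let ?S = "{\<mu>. gen_eigen_component M v \<mu> \<noteq> 0}"
  have "gen_eigen_component M v \<mu> \<in> dominated_by_pole M l m" if "\<mu> \<in> ?S" for \<mu>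
  proof -
    obtain k where "(eigen_shift M \<mu> ^^ k) (gen_eigen_component M v \<mu>) = 0" "\<mu> = l \<longrightarrow> k \<le> m"
      using gen_eigen_component_in_gen_eigenspace[of M v \<mu>] l
      by (cases "\<mu> = l") (auto simp: gen_eigenspace_def)
    thus ?thesis
      unfolding dominated_by_pole_def using fin[of \<mu>] that by (intro vec.span_base) blast
  qed
  hence "(\<Sum>\<mu>\<in>?S. gen_eigen_component M v \<mu>) \<in> dominated_by_pole M l m"
    unfolding dominated_by_pole_def by (intro vec.span_sum)
  moreover have "(\<Sum>\<mu>\<in>?S. gen_eigen_component M v \<mu>) = v"
    by (rule sum_gen_eigen_component[OF finite_gen_eigen_component order_refl])
  ultimately show ?thesis by simp
qed

text \<open>If \<open>l\<close> and \<open>l'\<close> were different points of one circle, the space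
  for \<open>l\<close> would allow unlimited order at \<open>l'\<close>; the third hypothesis
  excludes this.\<close>

lemma dominated_by_pole_mono:
  assumes "norm l \<le> norm l'" "l = l' \<Longrightarrow> m \<le> m'" "norm l = norm l' \<Longrightarrow> l = l'"
  shows "dominated_by_pole M l m \<subseteq> dominated_by_pole M l' m'"
  unfolding dominated_by_pole_def
proof (rule vec.span_mono, clarify)
  fix v \<mu> k
  assume *: "norm \<mu> \<le> norm l" "\<mu> = l \<longrightarrow> k \<le> m" "(eigen_shift M \<mu> ^^ k) v = 0"
  have "\<mu> = l' \<longrightarrow> k \<le> m'" using * assms by force
  thus "\<exists>\<mu> k. norm \<mu> \<le> norm l' \<and> (\<mu> = l' \<longrightarrow> k \<le> m') \<and> (eigen_shift M \<mu> ^^ k) v = 0"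
    using * assms(1) by (meson order_trans)
qed

lemma dominated_by_pole_invariant:
  assumes "v \<in> dominated_by_pole M l m"
  shows "M *v v \<in> dominated_by_pole M l m"
proof -
  let ?D = "dominated_by_pole M l m"
  have D: "vec.subspace ?D" unfolding dominated_by_pole_def by (rule vec.subspace_span)
  have "vec.subspace {v. M *v v \<in> ?D}"
    using D by (auto simp: vec.subspace_def matrix_vector_right_distrib vector_scalar_commute)
  moreover have "{v. \<exists>\<mu> k. norm \<mu> \<le> norm l \<and> (\<mu> = l \<longrightarrow> k \<le> m) \<and> (eigen_shift M \<mu> ^^ k) v = 0}
      \<subseteq> {v. M *v v \<in> ?D}"
  proof clarify
    fix v \<mu> k assume *: "norm \<mu> \<le> norm l" "\<mu> = l \<longrightarrow> k \<le> m" "(eigen_shift M \<mu> ^^ k) v = 0"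
    hence "(eigen_shift M \<mu> ^^ k) (M *v v) = 0" by (simp add: eigen_shift_pow_matrix_commute)
    thus "M *v v \<in> ?D" unfolding dominated_by_pole_def using * by (intro vec.span_base) blast
  qed
  ultimately have "?D \<subseteq> {v. M *v v \<in> ?D}"
    using vec.span_minimal unfolding dominated_by_pole_def by blast
  thus ?thesis using assms by blast
qed

text \<open>Domination is linear and invariant under the matrix, so the bound for \<open>x\<close>
  holds for all combinations of its orbit, which are the upper bounds for vectors of the
  face.\<close>

lemma dominated_by_pole_orbit_hull:
  fixes A :: "real^'n^'n"
  assumes x: "complex_vec x \<in> dominated_by_pole (map_matrix complex_of_real A) l m"
    and w: "w \<in> convex_cone hull (range (\<lambda>k. ((*v) A ^^ k) x))"
  shows "complex_vec w \<in> dominated_by_pole (map_matrix complex_of_real A) l m" (is "_ \<in> ?D")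
proof -
  have D: "vec.subspace ?D" unfolding dominated_by_pole_def by (rule vec.subspace_span)
  have "convex_cone hull (range (\<lambda>k. ((*v) A ^^ k) x)) \<subseteq> {w. complex_vec w \<in> ?D}"
  proof (rule hull_minimal)
    have "complex_vec (((*v) A ^^ k) x) \<in> ?D" for k
      using x by (induction k)
        (auto simp: dominated_by_pole_invariant simp flip: map_matrix_complex_vec)
    thus "range (\<lambda>k. ((*v) A ^^ k) x) \<subseteq> {w. complex_vec w \<in> ?D}" by auto
    show "convex_cone {w. complex_vec w \<in> ?D}"
      using D by (auto simp: convex_cone_iff complex_vec_add complex_vec_scale vec.subspace_def)
  qed
  thus ?thesis using w by blast
qed

text \<open>If the order of the component of \<open>g\<close> at \<open>l\<close> exceeded
  \<open>m\<close>, comparison with \<open>w\<close> would make every functional of the dual cone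
  vanish on the last nonzero iterate of that component. The modulus of \<open>l\<close> is maximal
  so that no component of \<open>g\<close> has a pole closer to the origin.\<close>

lemma component_order_bound:
  fixes A :: "real^'n^'n" and K :: "(real^'n) set"
  defines "M \<equiv> map_matrix complex_of_real A"
  assumes K: "proper_cone K" and A: "A \<in> cone_preserving K"
    and g: "g \<in> K" "w - g \<in> K"
    and l: "l \<noteq> 0" "\<And>\<mu>. gen_eigen_component M (complex_vec g) \<mu> \<noteq> 0 \<Longrightarrow> norm \<mu> \<le> norm l"
    and w: "complex_vec w \<in> dominated_by_pole M (of_real (norm l)) m"
  shows "(eigen_shift M l ^^ m) (gen_eigen_component M (complex_vec g) l) = 0"
proof -
  let ?y = "gen_eigen_component M (complex_vec g) l"
  have ex: "\<exists>k. (eigen_shift M l ^^ k) ?y = 0"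
    using gen_eigen_component_in_gen_eigenspace[of M "complex_vec g" l] by (auto simp: gen_eigenspace_def)
  define N where "N = (LEAST k. (eigen_shift M l ^^ k) ?y = 0)"
  have N: "(eigen_shift M l ^^ N) ?y = 0" unfolding N_def using ex by (rule LeastI_ex)
  have "N \<le> m"
  proof (rule ccontr)
    assume "\<not> N \<le> m"
    then obtain m' where m': "N = Suc m'" "m \<le> m'" by (cases N) auto
    \<comment> \<open>Without its component at \<open>l\<close>, the remainder of
      \<open>complex_vec g\<close> has order \<open>0\<close> there, as
      \<open>pole_comparison\<close> demands of \<open>u2\<close>.\<close>
    have "gen_eigen_component M (complex_vec g - ?y) \<mu>
        = (if \<mu> = l then 0 else gen_eigen_component M (complex_vec g) \<mu>)" for \<mu>
    proof -
      let ?c = "\<lambda>\<mu>. if \<mu> = l then 0 else gen_eigen_component M (complex_vec g) \<mu>"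
      let ?S = "insert l {\<mu>. gen_eigen_component M (complex_vec g) \<mu> \<noteq> 0}"
      have S: "finite ?S" by (simp add: finite_gen_eigen_component)
      have "complex_vec g = (\<Sum>\<mu>\<in>?S. gen_eigen_component M (complex_vec g) \<mu>)"
        by (rule sum_gen_eigen_component[OF S, symmetric]) auto
      also have "\<dots> = ?y + (\<Sum>\<mu>\<in>?S - {l}. gen_eigen_component M (complex_vec g) \<mu>)"
        using S by (subst sum.remove[of _ l]) auto
      also have "(\<Sum>\<mu>\<in>?S - {l}. gen_eigen_component M (complex_vec g) \<mu>) = (\<Sum>\<mu>\<in>?S - {l}. ?c \<mu>)"
        by (intro sum.cong) auto
      also have "\<dots> = (\<Sum>\<mu>\<in>?S. ?c \<mu>)"
        using S by (intro sum.mono_neutral_left) auto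
      finally have *: "complex_vec g = ?y + (\<Sum>\<mu>\<in>?S. ?c \<mu>)" .
      have "complex_vec g - ?y = (\<Sum>\<mu>\<in>?S. ?c \<mu>)"
        unfolding diff_eq_eq by (subst add.commute) (rule *)
      hence "gen_eigen_component M (complex_vec g - ?y) = ?c"
        by (intro gen_eigen_component_eq_sumI[OF S])
          (simp_all add: gen_eigen_component_in_gen_eigenspace vec.subspace_0[OF subspace_gen_eigenspace])
      thus ?thesis by simp
    qed
    hence rest: "complex_vec g - ?y \<in> dominated_by_pole M l 0"
      using l(2) by (intro dominated_by_poleI) (auto split: if_splits)
    have "real_functional a ((eigen_shift M l ^^ m') ?y) = 0" if a: "\<forall>y\<in>K. 0 \<le> inner a y" for a
    proof (rule pole_comparison[of "real_functional a" l M "complex_vec g"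
          "\<lambda>k. inner a (((*v) A ^^ k) g)" "complex_vec w" "\<lambda>k. inner a (((*v) A ^^ k) w)"
          ?y "complex_vec g - ?y"])
      show "moment M (real_functional a) k (complex_vec g) = complex_of_real (inner a (((*v) A ^^ k) g))"
        "moment M (real_functional a) k (complex_vec w) = complex_of_real (inner a (((*v) A ^^ k) w))"
        for k
        by (simp_all add: moment_def[OF real_functional_add real_functional_scale] M_def
            map_matrix_pow_complex_vec real_functional_complex_vec)
      show "0 \<le> inner a (((*v) A ^^ k) g)" for k
        using a cone_preserving_pow[OF A g(1)] by blast
      show "inner a (((*v) A ^^ k) g) \<le> inner a (((*v) A ^^ k) w)" for k
      proof -
        have "((*v) A ^^ k) (w - g) = ((*v) A ^^ k) w - ((*v) A ^^ k) g"
          by (induction k) (auto simp: matrix_vector_mult_diff_distrib)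
        thus ?thesis
          using a cone_preserving_pow[OF A g(2), of k] by (auto simp: inner_diff_right)
      qed
      \<comment> \<open>The bound \<open>m\<close> is weakened to \<open>m'\<close>, so that the
        comparison takes place at the actual order of the component.\<close>
      show "complex_vec w \<in> dominated_by_pole M (of_real (norm l)) m'"
        using w dominated_by_pole_mono[of "of_real (norm l)" "of_real (norm l)" m m' M] m'(2) by auto
    qed (use N m' rest l(1) real_functional_add real_functional_scale in auto)
    hence "(eigen_shift M l ^^ m') ?y = 0" by (rule real_functional_separates[OF K])
    hence "N \<le> m'" unfolding N_def by (rule Least_le)
    thus False using m' by simp
  qed
  thus ?thesis using eigen_shift_pow_mono[OF N] by blast
qed

text \<open>For the first bound, take a component of largest modulus: beyond \<open>r\<close> the
  generating function of \<open>w\<close> has no pole, so the order of that component would be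
  \<open>0\<close>. For the second, all components then lie within the circle through
  \<open>l\<close>, and the order bound applies.\<close>

lemma component_bounds:
  fixes A :: "real^'n^'n" and K :: "(real^'n) set"
  defines "M \<equiv> map_matrix complex_of_real A"
  assumes K: "proper_cone K" and A: "A \<in> cone_preserving K"
    and g: "g \<in> K" "w - g \<in> K" and r: "0 \<le> r"
    and w: "complex_vec w \<in> dominated_by_pole M (of_real r) m"
  shows "gen_eigen_component M (complex_vec g) l \<noteq> 0 \<Longrightarrow> norm l \<le> r"
    and "l \<noteq> 0 \<Longrightarrow> norm l = r \<Longrightarrow> (eigen_shift M l ^^ m) (gen_eigen_component M (complex_vec g) l) = 0"
proof -
  let ?c = "gen_eigen_component M (complex_vec g)"
  let ?S = "norm ` {l. ?c l \<noteq> 0}"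
  have fin: "finite ?S" by (simp add: finite_gen_eigen_component)
  have le: "norm l \<le> r" if l: "?c l \<noteq> 0" for l
  proof (rule ccontr)
    assume "\<not> norm l \<le> r"
    have ne: "?S \<noteq> {}" using l by blast
    have "Max ?S \<in> ?S" by (rule Max_in[OF fin ne])
    then obtain l' where l': "?c l' \<noteq> 0" "norm l' = Max ?S" by auto
    have max: "norm \<mu> \<le> norm l'" if "?c \<mu> \<noteq> 0" for \<mu>
      unfolding l'(2) using fin that by (intro Max_ge) auto
    have r': "r < norm l'" using max[OF l] \<open>\<not> norm l \<le> r\<close> by simp
    have "complex_vec w \<in> dominated_by_pole M (of_real (norm l')) 0"
      using w dominated_by_pole_mono[of "of_real r" "of_real (norm l')" m 0 M] r' r by auto
    from component_order_bound[OF K A g _ _ this[unfolded M_def]] max r' r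
    have "(eigen_shift M l' ^^ 0) (?c l') = 0" unfolding M_def by force
    thus False using l'(1) by simp
  qed
  thus "gen_eigen_component M (complex_vec g) l \<noteq> 0 \<Longrightarrow> norm l \<le> r" .
  assume "l \<noteq> 0" "norm l = r"
  thus "(eigen_shift M l ^^ m) (?c l) = 0"
    using component_order_bound[OF K A g, of l m] le w unfolding M_def by blast
qed

section \<open>Coordinates of the restriction to an invariant subspace\<close>

definition basis_comb :: "(real^'n) list \<Rightarrow> complex Matrix.vec \<Rightarrow> complex^'n" where
  "basis_comb bs v = (\<Sum>i<length bs. vec_index v i *s complex_vec (bs ! i))"

lemma basis_comb_add:
  assumes "u \<in> carrier_vec (length bs)" "v \<in> carrier_vec (length bs)"
  shows "basis_comb bs (u + v) = basis_comb bs u + basis_comb bs v"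
  using assms by (simp add: basis_comb_def sum.distrib vector_sadd_rdistrib)

lemma basis_comb_smult:
  assumes "v \<in> carrier_vec (length bs)"
  shows "basis_comb bs (c \<cdot>\<^sub>v v) = c *s basis_comb bs v"
  using assms by (simp add: basis_comb_def vec.scale_sum_right vector_smult_assoc)

text \<open>Real independence survives complexification because the real and imaginary parts of a
  complex relation are real relations.\<close>

lemma basis_comb_eq_0_iff:
  assumes bs: "is_basis_of bs W" and v: "v \<in> carrier_vec (length bs)"
  shows "basis_comb bs v = 0 \<longleftrightarrow> v = 0\<^sub>v (length bs)"
proof
  assume *: "basis_comb bs v = 0"
  have indep: "f i = 0" if sum: "(\<Sum>i<length bs. f i *\<^sub>R bs ! i) = 0" and i: "i < length bs"
    for f :: "nat \<Rightarrow> real" and i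
  proof -
    have d: "distinct bs" and ind: "\<not> Real_Vector_Spaces.dependent (set bs)"
      using bs by (auto simp: is_basis_of_def)
    \<comment> \<open>The relation is indexed by positions; distinctness of \<open>bs\<close> allows
      reading it as a relation indexed by the basis vectors.\<close>
    define h where "h b = f (the_inv_into {..<length bs} ((!) bs) b)" for b
    have bij: "bij_betw ((!) bs) {..<length bs} (set bs)" using d by (intro bij_betw_nth) auto
    have h: "h (bs ! i) = f i" if "i < length bs" for i
      using that bij by (simp add: h_def the_inv_into_f_f bij_betw_def)
    have "(\<Sum>b\<in>set bs. h b *\<^sub>R b) = (\<Sum>i<length bs. h (bs ! i) *\<^sub>R bs ! i)"
      by (rule sum.reindex_bij_betw[OF bij, symmetric])
    hence "(\<Sum>b\<in>set bs. h b *\<^sub>R b) = 0" using h sum by simp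
    hence "h (bs ! i) = 0"
      using i by (intro real_vector.independentD[OF ind finite_set subset_refl]) auto
    thus ?thesis using h i by simp
  qed
  have "(\<Sum>i<length bs. Re (vec_index v i) *\<^sub>R bs ! i) = 0" "(\<Sum>i<length bs. Im (vec_index v i) *\<^sub>R bs ! i) = 0"
    using * by (simp_all add: basis_comb_def Finite_Cartesian_Product.vec_eq_iff complex_eq_iff)
  from indep[OF this(1)] indep[OF this(2)] show "v = 0\<^sub>v (length bs)"
    using v by (intro eq_vecI) (auto simp: complex_eq_iff)
qed (simp add: basis_comb_def)

lemma basis_comb_diff:
  assumes "u \<in> carrier_vec (length bs)" "v \<in> carrier_vec (length bs)"
  shows "basis_comb bs (u - v) = basis_comb bs u - basis_comb bs v"
  using assms by (simp add: basis_comb_def sum_subtractf vector_sub_rdistrib)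

lemma basis_comb_inj:
  assumes "is_basis_of bs W" "u \<in> carrier_vec (length bs)" "v \<in> carrier_vec (length bs)"
    and eq: "basis_comb bs u = basis_comb bs v"
  shows "u = v"
proof -
  have "u - v = 0\<^sub>v (length bs)"
    using basis_comb_eq_0_iff[OF assms(1), of "u - v"] basis_comb_diff[OF assms(2,3)] assms(2,3) eq
    by simp
  hence "vec_index (u - v) i = 0" if "i < length bs" for i using that by simp
  thus ?thesis using assms(2,3) by (intro eq_vecI) auto
qed

lemma coord_matrix_carrier: "coord_matrix A bs \<in> carrier_mat (length bs) (length bs)"
  by (simp add: coord_matrix_def)

lemma basis_comb_coord_matrix:
  assumes bs: "is_basis_of bs W" and A: "(*v) A ` W \<subseteq> W" and v: "v \<in> carrier_vec (length bs)"
  shows "basis_comb bs (coord_matrix A bs *\<^sub>v v) = map_matrix complex_of_real A *v basis_comb bs v"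
proof -
  let ?r = "Real_Vector_Spaces.representation (set bs)"
  have col: "(\<Sum>i<length bs. complex_of_real (?r (A *v bs ! j) (bs ! i)) *s complex_vec (bs ! i))
      = complex_vec (A *v bs ! j)" if "j < length bs" for j
  proof -
    have "bs ! j \<in> W" using bs that by (auto simp: is_basis_of_def real_vector.span_base)
    hence "A *v bs ! j \<in> W" using A by blast
    from arg_cong[OF sum_representation_basis[OF bs this], of complex_vec]
    show ?thesis by (simp add: complex_vec_sum complex_vec_scale)
  qed
  have "basis_comb bs (coord_matrix A bs *\<^sub>v v)
      = (\<Sum>i<length bs. (\<Sum>j<length bs. complex_of_real (?r (A *v bs ! j) (bs ! i)) * vec_index v j) *s complex_vec (bs ! i))"
    unfolding basis_comb_def using v
    by (intro sum.cong) (auto simp: coord_matrix_def scalar_prod_def atLeast0LessThan)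
  also have "\<dots> = (\<Sum>i<length bs. \<Sum>j<length bs. vec_index v j *s (complex_of_real (?r (A *v bs ! j) (bs ! i)) *s complex_vec (bs ! i)))"
    by (simp add: vec.scale_sum_left vector_smult_assoc mult.commute)
  also have "\<dots> = (\<Sum>j<length bs. \<Sum>i<length bs. vec_index v j *s (complex_of_real (?r (A *v bs ! j) (bs ! i)) *s complex_vec (bs ! i)))"
    by (rule sum.swap)
  also have "\<dots> = (\<Sum>j<length bs. vec_index v j *s complex_vec (A *v bs ! j))"
    by (intro sum.cong refl) (simp only: vec.scale_sum_right[symmetric] col lessThan_iff)
  also have "\<dots> = map_matrix complex_of_real A *v basis_comb bs v"
    unfolding basis_comb_def
    by (simp add: vec.linear_sum[OF matrix_vector_mul_linear_gen] vector_scalar_commute map_matrix_complex_vec)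
  finally show ?thesis .
qed

text \<open>The sign compares \<open>char_matrix\<close>, the matrix minus \<open>l\<close>, with
  \<open>eigen_shift\<close>, which is \<open>l\<close> minus the matrix. Being a nonzero scalar, it
  leaves the kernels of corresponding powers in agreement.\<close>

lemma basis_comb_char_matrix_pow:
  assumes bs: "is_basis_of bs W" and A: "(*v) A ` W \<subseteq> W" and v: "v \<in> carrier_vec (length bs)"
  shows "basis_comb bs ((char_matrix (coord_matrix A bs) l ^\<^sub>m k) *\<^sub>v v)
    = (- 1) ^ k *s (eigen_shift (map_matrix complex_of_real A) l ^^ k) (basis_comb bs v)"
  using v
proof (induction k arbitrary: v)
  case 0
  have "char_matrix (coord_matrix A bs) l \<in> carrier_mat (length bs) (length bs)"
    using coord_matrix_carrier[of A bs] by simp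
  from carrier_matD(1)[OF this] show ?case using 0 by simp
next
  case (Suc k)
  let ?n = "length bs" and ?C = "char_matrix (coord_matrix A bs) l"
  let ?E = "eigen_shift (map_matrix complex_of_real A) l"
  note B = coord_matrix_carrier[of A bs]
  have C: "?C \<in> carrier_mat ?n ?n" using B by simp
  have Cv: "?C *\<^sub>v v \<in> carrier_vec ?n" using C Suc.prems by simp
  have "?C *\<^sub>v v = coord_matrix A bs *\<^sub>v v + (- l) \<cdot>\<^sub>v v"
  proof -
    have "((- l) \<cdot>\<^sub>m 1\<^sub>m ?n) *\<^sub>v v = (- l) \<cdot>\<^sub>v v"
      using Suc.prems by (intro eq_vecI) (auto simp: row_smult)
    thus ?thesis
      using B Suc.prems unfolding char_matrix_def
      by (subst add_mult_distrib_mat_vec[of _ ?n ?n]) auto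
  qed
  hence step: "basis_comb bs (?C *\<^sub>v v) = - ?E (basis_comb bs v)"
    using B Suc.prems basis_comb_coord_matrix[OF bs A Suc.prems]
    by (simp add: basis_comb_add basis_comb_smult eigen_shift_eq)
  have "basis_comb bs ((?C ^\<^sub>m Suc k) *\<^sub>v v) = basis_comb bs ((?C ^\<^sub>m k) *\<^sub>v (?C *\<^sub>v v))"
    using assoc_mult_mat_vec[OF pow_carrier_mat[OF C] C Suc.prems] by simp
  also have "\<dots> = (- 1) ^ k *s (?E ^^ k) (- ?E (basis_comb bs v))"
    unfolding Suc.IH[OF Cv] step ..
  also have "- ?E (basis_comb bs v) = (- 1) *s ?E (basis_comb bs v)" by simp
  also have "(- 1) ^ k *s (?E ^^ k) ((- 1) *s ?E (basis_comb bs v)) = (- 1) ^ Suc k *s (?E ^^ Suc k) (basis_comb bs v)"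
    by (simp only: eigen_shift_pow_scale vector_smult_assoc funpow_Suc_right o_apply power_Suc2)
  finally show ?case .
qed

lemma subspace_basis_comb_range:
  "vec.subspace (basis_comb bs ` carrier_vec (length bs))" (is "vec.subspace ?U")
proof (rule vec.subspaceI)
  have "basis_comb bs (0\<^sub>v (length bs)) = 0" by (simp add: basis_comb_def)
  thus "0 \<in> ?U" by (metis imageI zero_carrier_vec)
next
  fix u v assume "u \<in> ?U" "v \<in> ?U"
  thus "u + v \<in> ?U"
    by (auto simp: basis_comb_add[symmetric] intro!: imageI)
next
  fix c u assume "u \<in> ?U"
  thus "c *s u \<in> ?U"
    by (auto simp: basis_comb_smult[symmetric] intro!: imageI)
qed

lemma complex_vec_in_basis_comb_range:
  assumes bs: "is_basis_of bs W" and v: "v \<in> W"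
  shows "complex_vec v \<in> basis_comb bs ` carrier_vec (length bs)"
proof -
  let ?u = "Matrix.vec (length bs)
    (\<lambda>i. complex_of_real (Real_Vector_Spaces.representation (set bs) v (bs ! i)))"
  have "basis_comb bs ?u = complex_vec v"
    using arg_cong[OF sum_representation_basis[OF bs v], of complex_vec]
    by (simp add: basis_comb_def complex_vec_sum complex_vec_scale)
  thus ?thesis by (metis imageI vec_carrier)
qed

text \<open>As the vectors of \<open>G\<close> generate the complexified subspace, linear conditions
  need only be checked on \<open>G\<close>.\<close>

lemma basis_comb_range_subset:
  assumes bs: "is_basis_of bs (Real_Vector_Spaces.span G)"
  shows "basis_comb bs ` carrier_vec (length bs) \<subseteq> vec.span (complex_vec ` G)"
proof clarify
  fix v
  have "complex_vec g \<in> vec.span (complex_vec ` G)" if "g \<in> Real_Vector_Spaces.span G" for g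
    using that
  proof (induction rule: real_vector.span_induct)
    case base
    show ?case
      by (auto simp: real_vector.subspace_def complex_vec_add complex_vec_scale
          intro: vec.span_zero vec.span_add vec.span_scale)
  qed (auto intro: vec.span_base)
  moreover have "bs ! i \<in> Real_Vector_Spaces.span G" if "i < length bs" for i
    using real_vector.span_base[OF nth_mem[OF that]] bs by (simp add: is_basis_of_def)
  ultimately have "complex_vec (bs ! i) \<in> vec.span (complex_vec ` G)" if "i < length bs" for i
    using that by blast
  thus "basis_comb bs v \<in> vec.span (complex_vec ` G)"
    unfolding basis_comb_def by (intro vec.span_sum vec.span_scale) simp
qed

text \<open>The bounds on \<open>G\<close> extend to the complexified span and limit the spectral
  radius and the index from above; the component of \<open>x\<close> at \<open>r\<close>, which lies
  in that span by invariance, attains both.\<close>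

lemma restriction_spectral_data:
  fixes A :: "real^'n^'n" and G :: "(real^'n) set"
  defines "M \<equiv> map_matrix complex_of_real A" and "W \<equiv> Real_Vector_Spaces.span G"
  assumes A: "(*v) A ` G \<subseteq> G" and x: "x \<in> G" and r: "0 \<le> r"
    and xr: "(eigen_shift M (of_real r) ^^ m) (gen_eigen_component M (complex_vec x) (of_real r)) \<noteq> 0"
    and bound: "\<And>g l. g \<in> G \<Longrightarrow> gen_eigen_component M (complex_vec g) l \<noteq> 0 \<Longrightarrow> norm l \<le> r"
    and order: "\<And>g. g \<in> G \<Longrightarrow>
      (eigen_shift M (of_real r) ^^ Suc m) (gen_eigen_component M (complex_vec g) (of_real r)) = 0"
  shows "spectral_radius (restriction_matrix A W) = r"
    and "eigenvalue_index (restriction_matrix A W) (of_real r) = Suc m"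
proof -
  define bs where "bs = (SOME bs. is_basis_of bs W)"
  let ?n = "length bs" and ?B = "coord_matrix A bs" and ?\<rho> = "complex_of_real r"
  let ?U = "basis_comb bs ` carrier_vec ?n"
  have bs: "is_basis_of bs W"
    unfolding bs_def by (rule someI_ex[OF ex_is_basis_of]) (simp add: W_def)
  have R: "restriction_matrix A W = ?B" by (simp add: restriction_matrix_def bs_def)
  have AW: "(*v) A ` W \<subseteq> W"
  proof -
    have "(*v) A ` W = Real_Vector_Spaces.span ((*v) A ` G)"
      unfolding W_def by (rule linear_span_image[symmetric]) (rule matrix_vector_mul_linear)
    thus ?thesis using real_vector.span_mono[OF A] by (simp add: W_def)
  qed
  have B: "?B \<in> carrier_mat ?n ?n" by (rule coord_matrix_carrier)
  have U: "vec.subspace ?U" by (rule subspace_basis_comb_range)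
  have UM: "M *v u \<in> ?U" if "u \<in> ?U" for u
    using that B by (auto simp: M_def basis_comb_coord_matrix[OF bs AW, symmetric] intro!: imageI)
  have UE: "(eigen_shift M l ^^ k) u \<in> ?U" if "u \<in> ?U" for u l k
    using that by (induction k) (auto simp: eigen_shift_eq intro!: vec.subspace_diff[OF U]
        vec.subspace_scale[OF U] UM simp del: vector_sub_rdistrib)
  \<comment> \<open>Both conditions are preserved by linear combinations because taking a component
    is linear.\<close>
  have bounds: "(\<forall>l. gen_eigen_component M u l \<noteq> 0 \<longrightarrow> norm l \<le> r)
    \<and> (eigen_shift M ?\<rho> ^^ Suc m) (gen_eigen_component M u ?\<rho>) = 0" if "u \<in> ?U" for u
  proof -
    let ?P = "{u. (\<forall>l. gen_eigen_component M u l \<noteq> 0 \<longrightarrow> norm l \<le> r)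
      \<and> (eigen_shift M ?\<rho> ^^ Suc m) (gen_eigen_component M u ?\<rho>) = 0}"
    have "vec.subspace ?P"
    proof (rule vec.subspaceI)
      show "0 \<in> ?P" by (simp add: gen_eigen_component_zero del: funpow.simps)
    next
      fix u v assume "u \<in> ?P" "v \<in> ?P"
      thus "u + v \<in> ?P"
        by (auto simp: gen_eigen_component_add eigen_shift_pow_add simp del: funpow.simps)
          (metis add_0)
    next
      fix c u assume "u \<in> ?P"
      thus "c *s u \<in> ?P"
        by (auto simp: gen_eigen_component_scale eigen_shift_pow_scale simp del: funpow.simps)
    qed
    moreover have "complex_vec ` G \<subseteq> ?P"
      using bound order by (auto simp del: funpow.simps)
    ultimately have "vec.span (complex_vec ` G) \<subseteq> ?P" by (intro vec.span_minimal)
    thus ?thesis using that basis_comb_range_subset[OF bs[unfolded W_def]] by blast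
  qed
  have shift: "basis_comb bs ((char_matrix ?B l ^\<^sub>m k) *\<^sub>v v) = 0
      \<longleftrightarrow> (eigen_shift M l ^^ k) (basis_comb bs v) = 0" if "v \<in> carrier_vec ?n" for v l k
    using basis_comb_char_matrix_pow[OF bs AW that, of l k] by (simp add: M_def vec.scale_eq_0_iff)
  have kernel: "mat_kernel (char_matrix ?B l ^\<^sub>m k)
      = {v \<in> carrier_vec ?n. (eigen_shift M l ^^ k) (basis_comb bs v) = 0}" for l k
  proof -
    have C: "char_matrix ?B l ^\<^sub>m k \<in> carrier_mat ?n ?n" using B by simp
    have "(char_matrix ?B l ^\<^sub>m k) *\<^sub>v v = 0\<^sub>v ?n
        \<longleftrightarrow> (eigen_shift M l ^^ k) (basis_comb bs v) = 0" if v: "v \<in> carrier_vec ?n" for v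
      using basis_comb_eq_0_iff[OF bs mult_mat_vec_carrier[OF C v]] shift[OF v] by simp
    thus ?thesis unfolding mat_kernel[OF C] by blast
  qed
  let ?y = "gen_eigen_component M (complex_vec x) ?\<rho>"
  have "x \<in> W" using x by (simp add: W_def real_vector.span_base)
  hence "?y \<in> ?U"
    by (intro gen_eigen_component_in_invariant[OF U UM] complex_vec_in_basis_comb_range[OF bs])
  then obtain v where v: "v \<in> carrier_vec ?n" "basis_comb bs v = ?y" by auto
  have "eigenvalue_index ?B ?\<rho> = Suc m"
  proof (rule eigenvalue_index_eqI[OF B])
    \<comment> \<open>The coordinates of the component of \<open>x\<close> at \<open>r\<close>
      witness the growth of the kernels after the power \<open>m\<close>.\<close>
    have "v \<in> mat_kernel (char_matrix ?B ?\<rho> ^\<^sub>m Suc m)" "v \<notin> mat_kernel (char_matrix ?B ?\<rho> ^\<^sub>m m)"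
      unfolding kernel using v order[OF x] xr by (auto simp del: funpow.simps)
    thus "mat_kernel (char_matrix ?B ?\<rho> ^\<^sub>m m) \<noteq> mat_kernel (char_matrix ?B ?\<rho> ^\<^sub>m Suc m)" by metis
    \<comment> \<open>A vector killed by a power of the shift is its own component, so the bound on
      components makes the kernels stationary.\<close>
    have "(eigen_shift M ?\<rho> ^^ Suc m) u = 0"
      if u: "u \<in> ?U" "(eigen_shift M ?\<rho> ^^ Suc (Suc m)) u = 0" for u
    proof -
      have "u \<in> gen_eigenspace M ?\<rho>" using u(2) unfolding gen_eigenspace_def by blast
      thus ?thesis using bounds[OF u(1)] by (simp only: gen_eigen_component_of_gen_eigenspace)
    qed
    moreover have "(eigen_shift M ?\<rho> ^^ Suc (Suc m)) u = 0" if "(eigen_shift M ?\<rho> ^^ Suc m) u = 0" for u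
      using that by (rule eigen_shift_pow_mono) simp
    ultimately have eq: "(eigen_shift M ?\<rho> ^^ Suc (Suc m)) u = 0 \<longleftrightarrow> (eigen_shift M ?\<rho> ^^ Suc m) u = 0"
      if "u \<in> ?U" for u
      using that by (intro iffI)
    show "mat_kernel (char_matrix ?B ?\<rho> ^\<^sub>m Suc (Suc m)) = mat_kernel (char_matrix ?B ?\<rho> ^\<^sub>m Suc m)"
      unfolding kernel by (intro Collect_cong conj_cong refl eq imageI)
  qed
  thus "eigenvalue_index (restriction_matrix A W) (of_real r) = Suc m" unfolding R .
  have eig: "eigenvalue ?B l \<longleftrightarrow> (\<exists>u\<in>?U. u \<noteq> 0 \<and> eigen_shift M l u = 0)" for l
  proof -
    have "?B *\<^sub>v v = l \<cdot>\<^sub>v v \<longleftrightarrow> eigen_shift M l (basis_comb bs v) = 0" if v: "v \<in> carrier_vec ?n" for v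
    proof -
      have "?B *\<^sub>v v = l \<cdot>\<^sub>v v \<longleftrightarrow> basis_comb bs (?B *\<^sub>v v) = basis_comb bs (l \<cdot>\<^sub>v v)"
        using basis_comb_inj[OF bs mult_mat_vec_carrier[OF B v], of "l \<cdot>\<^sub>v v"] v by auto
      also have "\<dots> \<longleftrightarrow> M *v basis_comb bs v = l *s basis_comb bs v"
        using basis_comb_coord_matrix[OF bs AW v] basis_comb_smult[OF v] by (simp add: M_def)
      finally show ?thesis by (auto simp: eigen_shift_eq)
    qed
    thus ?thesis
      using basis_comb_eq_0_iff[OF bs] B unfolding eigenvalue_def eigenvector_def by auto
  qed
  have "spectral_radius ?B = r"
    unfolding spectral_radius_def
  proof (rule Max_eqI)
    show "finite (norm ` spectrum ?B)" using card_finite_spectrum[OF B] by blast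
    fix s assume "s \<in> norm ` spectrum ?B"
    then obtain l where l: "eigenvalue ?B l" "s = norm l" by (auto simp: spectrum_def)
    then obtain u where u: "u \<in> ?U" "u \<noteq> 0" "eigen_shift M l u = 0" using eig by blast
    have "(eigen_shift M l ^^ 1) u = 0" using u(3) by simp
    hence "u \<in> gen_eigenspace M l" unfolding gen_eigenspace_def by blast
    hence "gen_eigen_component M u l \<noteq> 0" using u(2) by (simp add: gen_eigen_component_of_gen_eigenspace)
    thus "s \<le> r" using bounds[OF u(1)] l(2) by blast
  next
    \<comment> \<open>The last nonzero iterate of the component of \<open>x\<close> is an
      eigenvector for \<open>r\<close>.\<close>
    have "eigen_shift M ?\<rho> ((eigen_shift M ?\<rho> ^^ m) ?y) = 0" using order[OF x] by simp
    hence "eigenvalue ?B ?\<rho>" using eig UE[OF \<open>?y \<in> ?U\<close>] xr by blast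
    thus "r \<in> norm ` spectrum ?B"
      using r by (auto simp: spectrum_def intro!: image_eqI[of _ _ ?\<rho>])
  qed
  thus "spectral_radius (restriction_matrix A W) = r" unfolding R .
qed

text \<open>Perron-Frobenius for a single vector: comparing the cone vector with itself shows that
  its component at the nonnegative number \<open>r\<close> is nonzero and has the largest order on
  the circle of radius \<open>r\<close>.\<close>

lemma spectral_pair_of_cone_vector:
  fixes A :: "real^'n^'n" and K :: "(real^'n) set"
  defines "M \<equiv> map_matrix complex_of_real A"
  assumes K: "proper_cone K" and A: "A \<in> cone_preserving K" and x: "x \<in> K" "x \<noteq> 0"
  obtains r m where "0 \<le> r" "spectral_pair M (complex_vec x) = (r, Suc m)"
    "complex_vec x \<in> dominated_by_pole M (of_real r) (Suc m)"
    "(eigen_shift M (of_real r) ^^ m) (gen_eigen_component M (complex_vec x) (of_real r)) \<noteq> 0"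
    "(eigen_shift M (of_real r) ^^ Suc m) (gen_eigen_component M (complex_vec x) (of_real r)) = 0"
    "\<And>l. gen_eigen_component M (complex_vec x) l \<noteq> 0 \<Longrightarrow> norm l \<le> r"
proof -
  let ?c = "gen_eigen_component M (complex_vec x)"
  define r where "r = local_spectral_radius M (complex_vec x)"
  let ?\<rho> = "complex_of_real r"
  let ?S = "{l. ?c l \<noteq> 0}"
  have fin: "finite ?S" by (rule finite_gen_eigen_component)
  have ne: "?S \<noteq> {}"
    using sum_gen_eigen_component[OF fin order_refl] x(2)
    by (metis complex_vec_eq_0_iff sum.empty)
  have r_eq: "r = Max (norm ` ?S)"
    by (simp add: r_def local_spectral_radius_def occurring_eigenvalues_def)
  have "r \<in> norm ` ?S" unfolding r_eq using fin ne by (intro Max_in) auto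
  then obtain l0 where l0: "?c l0 \<noteq> 0" "norm l0 = r" by auto
  have r0: "0 \<le> r" using l0(2) norm_ge_zero[of l0] by simp
  have bound: "norm l \<le> r" if "?c l \<noteq> 0" for l
    unfolding r_eq using fin that by (intro Max_ge) auto
  define N where "N = (LEAST k. (eigen_shift M ?\<rho> ^^ k) (?c ?\<rho>) = 0)"
  have "\<exists>k. (eigen_shift M ?\<rho> ^^ k) (?c ?\<rho>) = 0"
    using gen_eigen_component_in_gen_eigenspace[of M "complex_vec x" ?\<rho>] by (auto simp: gen_eigenspace_def)
  hence N: "(eigen_shift M ?\<rho> ^^ N) (?c ?\<rho>) = 0" unfolding N_def by (rule LeastI_ex)
  have dom: "complex_vec x \<in> dominated_by_pole M ?\<rho> N"
    using bound N r0 by (intro dominated_by_poleI) auto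
  \<comment> \<open>The vector \<open>x\<close> plays the role of both \<open>g\<close> and
    \<open>w\<close> in \<open>component_bounds\<close>.\<close>
  have x0: "x - x \<in> K" using K by (auto simp: proper_cone_def dest: convex_cone_contains_0)
  have ord: "(eigen_shift M l ^^ N) (?c l) = 0" if "norm l = r" for l
  proof (cases "l = 0")
    case True
    thus ?thesis using N that by simp
  next
    case False
    thus ?thesis
      using component_bounds(2)[OF K A x(1) x0 r0] dom that unfolding M_def by blast
  qed
  \<comment> \<open>If \<open>N\<close> were \<open>0\<close>, \<open>ord\<close> would make the
    component at \<open>l0\<close> vanish, although \<open>l0\<close> occurs and has modulus
    \<open>r\<close>.\<close>
  have "N \<noteq> 0" using ord[OF l0(2)] l0(1) by (cases N) auto
  then obtain m where m: "N = Suc m" by (cases N) auto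
  have xm: "(eigen_shift M ?\<rho> ^^ m) (?c ?\<rho>) \<noteq> 0"
    using not_less_Least[of m "\<lambda>k. (eigen_shift M ?\<rho> ^^ k) (?c ?\<rho>) = 0"] m unfolding N_def by auto
  hence c\<rho>: "?c ?\<rho> \<noteq> 0" by (metis eigen_shift_pow_zero)
  have "vector_order M (complex_vec x) = N"
    unfolding vector_order_def r_def[symmetric] occurring_eigenvalues_def
  proof (rule Max_eqI)
    show "finite ((\<lambda>l. gen_eigenvector_order M l (?c l)) ` {l \<in> {l. ?c l \<noteq> 0}. norm l = r})"
      using fin by simp
    fix k assume "k \<in> (\<lambda>l. gen_eigenvector_order M l (?c l)) ` {l \<in> {l. ?c l \<noteq> 0}. norm l = r}"
    then obtain l where "norm l = r" "k = gen_eigenvector_order M l (?c l)" by auto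
    thus "k \<le> N"
      unfolding gen_eigenvector_order_def using ord m by (auto intro!: Least_le simp del: funpow.simps)
  next
    have "gen_eigenvector_order M ?\<rho> (?c ?\<rho>) = N"
      unfolding gen_eigenvector_order_def
    proof (rule Least_equality)
      show "0 < N \<and> (eigen_shift M ?\<rho> ^^ N) (?c ?\<rho>) = 0" using N m by (simp del: funpow.simps)
      fix k assume "0 < k \<and> (eigen_shift M ?\<rho> ^^ k) (?c ?\<rho>) = 0"
      thus "N \<le> k" unfolding N_def by (intro Least_le) blast
    qed
    thus "N \<in> (\<lambda>l. gen_eigenvector_order M l (?c l)) ` {l \<in> {l. ?c l \<noteq> 0}. norm l = r}"
      using c\<rho> r0 by (intro image_eqI[of _ _ ?\<rho>]) auto
  qed
  hence "spectral_pair M (complex_vec x) = (r, Suc m)"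
    using x(2) m by (simp add: spectral_pair_def r_def)
  thus thesis using that[OF r0 _ _ xm] dom N bound m by blast
qed

theorem theorem4p6:
  fixes K F :: "(real^'n) set" and A :: "real^'n^'n" and x :: "real^'n"
  assumes "proper_cone K"
    and "A \<in> cone_preserving K"
    and "cone_face K F"
    and "x \<in> rel_interior F"
  shows "let G = least_invariant_face A K F; B = restriction_matrix A (Real_Vector_Spaces.span G)
    in spectral_pair (map_matrix complex_of_real A) (complex_vec x) =
      (if G = {0} then (0, 0)
       else (spectral_radius B, eigenvalue_index B (complex_of_real (spectral_radius B))))"
proof -
  define G where "G = least_invariant_face A K F"
  define M where "M = map_matrix complex_of_real A"
  let ?W = "convex_cone hull (range (\<lambda>k. ((*v) A ^^ k) x))"
  have Kcc: "convex_cone K" and pointed: "K \<inter> uminus ` K = {0}"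
    using assms(1) by (auto simp: proper_cone_def)
  have FK: "F \<subseteq> K" using assms(3) by (simp add: cone_face_def)
  have xF: "x \<in> F" using assms(4) rel_interior_subset by blast
  have "invariant_face A K G" "F \<subseteq> G"
    using least_invariant_face_works(2)[OF Kcc assms(2) FK] by (auto simp: G_def)
  hence G: "convex_cone G" "G \<subseteq> K" "(*v) A ` G \<subseteq> G" "x \<in> G"
    using xF by (auto simp: invariant_face_def cone_face_def)
  have dominated: "\<exists>w\<in>?W. w - g \<in> K" if "g \<in> G" for g
    using least_invariant_face_dominated[OF Kcc assms(2,3,4)] that by (simp add: G_def)
  have zero: "y = 0" if "y \<in> K" "- y \<in> K" for y
  proof -
    have "y \<in> uminus ` K" using that(2) by (metis imageI minus_minus)
    thus ?thesis using that(1) pointed by blast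
  qed
  show ?thesis
  proof (cases "x = 0")
    case True
    have "((*v) A ^^ k) x = 0" for k using True by (induction k) auto
    \<comment> \<open>All dominating vectors are zero, so \<open>- g\<close> lies in
      \<open>K\<close> for each \<open>g\<close> of the face; pointedness gives
      \<open>G = {0}\<close>, the case with the conventional pair \<open>(0, 0)\<close>.\<close>
    hence "?W \<subseteq> {0}"
      by (intro hull_minimal) (auto simp: convex_cone_iff)
    hence "g = 0" if "g \<in> G" for g
      using dominated[OF that] zero[of g] that G(2) by force
    hence "G = {0}" using G(4) True by blast
    thus ?thesis using True by (simp add: G_def[symmetric] spectral_pair_def)
  next
    case False
    obtain r m where r: "0 \<le> r" and sp: "spectral_pair M (complex_vec x) = (r, Suc m)"
      and dom: "complex_vec x \<in> dominated_by_pole M (of_real r) (Suc m)"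
      and xm: "(eigen_shift M (of_real r) ^^ m) (gen_eigen_component M (complex_vec x) (of_real r)) \<noteq> 0"
      and xSm: "(eigen_shift M (of_real r) ^^ Suc m) (gen_eigen_component M (complex_vec x) (of_real r)) = 0"
      and xr: "\<And>l. gen_eigen_component M (complex_vec x) l \<noteq> 0 \<Longrightarrow> norm l \<le> r"
      using spectral_pair_of_cone_vector[OF assms(1,2) _ False] G unfolding M_def by blast
    have bound: "norm l \<le> r" if g: "g \<in> G" and l: "gen_eigen_component M (complex_vec g) l \<noteq> 0" for g l
    proof -
      obtain w where w: "w \<in> ?W" "w - g \<in> K" using dominated[OF g] by blast
      have "g \<in> K" using g G(2) by blast
      from component_bounds(1)[OF assms(1,2) this w(2) r dominated_by_pole_orbit_hull[OF dom[unfolded M_def] w(1)]]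
      show ?thesis using l unfolding M_def by blast
    qed
    have order: "(eigen_shift M (of_real r) ^^ Suc m) (gen_eigen_component M (complex_vec g) (of_real r)) = 0"
      if g: "g \<in> G" for g
    proof -
      obtain w where w: "w \<in> ?W" "w - g \<in> K" using dominated[OF g] by blast
      have gK: "g \<in> K" using g G(2) by blast
      show ?thesis
      proof (cases "r = 0")
        case False
        with component_bounds(2)[OF assms(1,2) gK w(2) r dominated_by_pole_orbit_hull[OF dom[unfolded M_def] w(1)],
            of "of_real r"] r
        show ?thesis unfolding M_def by (simp del: funpow.simps)
      next
        \<comment> \<open>For \<open>r = 0\<close> there is no point \<open>1 / r\<close>;
          nilpotency replaces the pole argument. The power \<open>Suc m\<close> of \<open>A\<close>
          kills \<open>x\<close>, hence the orbit hull with \<open>w\<close>; then the image of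
          \<open>g\<close> and its negative both lie in \<open>K\<close>.\<close>
        case True
        have E0: "(eigen_shift M 0 ^^ k) (complex_vec v) = complex_vec ((- 1) ^ k *\<^sub>R ((*v) A ^^ k) v)" for k v
        proof (induction k)
          case (Suc k)
          have "eigen_shift M 0 (complex_vec u) = complex_vec (- (A *v u))" for u
            by (simp add: eigen_shift_eq M_def map_matrix_complex_vec Finite_Cartesian_Product.vec_eq_iff)
          thus ?case using Suc.IH by (simp add: matrix_vector_mult_scaleR)
        qed simp
        let ?A = "\<lambda>v. ((*v) A ^^ Suc m) v"
        \<comment> \<open>As \<open>r = 0\<close>, only the eigenvalue \<open>0\<close> can occur,
          so \<open>x\<close> equals its component at \<open>0\<close>.\<close>
        have "gen_eigen_component M (complex_vec x) l = 0" if "l \<noteq> 0" for l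
          using xr[of l] True that by auto
        hence "(\<Sum>l\<in>{0}. gen_eigen_component M (complex_vec x) l) = complex_vec x"
          by (intro sum_gen_eigen_component) auto
        hence "(eigen_shift M 0 ^^ Suc m) (complex_vec x) = 0" using xSm True by simp
        hence Ax: "?A x = 0" unfolding E0 by simp
        have "linear ((*v) A ^^ k)" for k
        proof (induction k)
          case (Suc k)
          show ?case
            unfolding funpow.simps by (rule linear_compose[OF Suc.IH matrix_vector_mul_linear])
        qed (simp add: linear_iff)
        hence lin: "linear ?A" .
        have "?W \<subseteq> {w. ?A w = 0}"
        proof (rule hull_minimal)
          have "?A (((*v) A ^^ k) x) = ((*v) A ^^ k) (?A x)" for k
            by (metis add.commute comp_apply funpow_add)
          moreover have "((*v) A ^^ k) 0 = 0" for k by (induction k) auto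
          ultimately show "range (\<lambda>k. ((*v) A ^^ k) x) \<subseteq> {w. ?A w = 0}"
            using Ax by (auto simp del: funpow.simps)
          show "convex_cone {w. ?A w = 0}"
            unfolding convex_cone_iff
            by (simp add: linear_0[OF lin] linear_add[OF lin] linear_scale[OF lin] del: funpow.simps)
        qed
        hence "?A w = 0" using w(1) by blast
        moreover have "?A (w - g) = ?A w - ?A g" by (rule linear_diff[OF lin])
        ultimately have "- ?A g \<in> K" "?A g \<in> K"
          using cone_preserving_pow[OF assms(2) w(2), of "Suc m"] cone_preserving_pow[OF assms(2) gK, of "Suc m"]
          by (simp_all del: funpow.simps)
        hence "?A g = 0" using zero by blast
        hence g0: "(eigen_shift M 0 ^^ Suc m) (complex_vec g) = 0" unfolding E0 by simp
        hence "complex_vec g \<in> gen_eigenspace M 0" unfolding gen_eigenspace_def by blast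
        thus ?thesis using g0 True by (simp only: gen_eigen_component_of_gen_eigenspace of_real_0)
      qed
    qed
    have "G \<noteq> {0}" using False G(4) by blast
    moreover note restriction_spectral_data[OF G(3,4) r xm[unfolded M_def] bound[unfolded M_def] order[unfolded M_def]]
    ultimately show ?thesis using sp by (simp add: G_def[symmetric] M_def Let_def)
  qed
qed

end
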